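(* Let $F:(M^m,g)\to(B^n,g')$ be a Clairaut conformal submersion between Riemannian manifolds with connected fibers, dilation $\lambda$ and $r=e^f$, where $f:M\to\mathbb{R}$ is smooth. Then $F:(M,\lambda^2 g)\to(B,g')$ is a Clairaut Riemannian submersion with $r=\lambda e^{f}$.
   Context: All manifolds, maps and functions are smooth; $\dim M=m$, $\dim B=n$. For a submersion $F:(M,g)\to(B,g')$, the vertical distribution is $\ker F_\ast$ and the horizontal distribution is its $g$-orthogonal complement. $F$ is a conformal submersion with dilation $\lambda:M\to\mathbb{R}^+$ if $g'(F_\ast X,F_\ast Y)=\lambda^2 g(X,Y)$ for all horizontal $X,Y$; it is a Riemannian submersion if $\lambda\equiv 1$. A conformal (resp. Riemannian) submersion $F$ is a Clairaut conformal (resp. Clairaut Riemannian) submersion with function $r:M\to\mathbb{R}^+$ if for every geodesic $\alpha$ of the metric on $M$ the function $t\mapsto r(\alpha(t))\sin\omega(t)$ is constant, where $\omega(t)\in[0,\pi/2]$ is the angle between $\dot\alpha(t)$ and the horizontal space at $\alpha(t)$. *)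

theory Defs
  imports "HOL-Analysis.Analysis"
begin

section \<open>Smooth maps between open subsets of normed spaces\<close>

text \<open>The set \<open>S\<close> is always open and the domain finite-dimensional below, so
  continuity of all iterated directional derivatives is the usual \<open>C\<^sup>k\<close> condition.\<close>

primrec Ck_on :: "nat \<Rightarrow> ('a::real_normed_vector \<Rightarrow> 'b::real_normed_vector) \<Rightarrow> 'a set \<Rightarrow> bool" where
  "Ck_on 0 f S \<longleftrightarrow> continuous_on S f"
| "Ck_on (Suc k) f S \<longleftrightarrow>
     (\<forall>x\<in>S. f differentiable (at x)) \<and> (\<forall>v. Ck_on k (\<lambda>x. frechet_derivative f (at x) v) S)"

definition smooth_on :: "('a::real_normed_vector \<Rightarrow> 'b::real_normed_vector) \<Rightarrow> 'a set \<Rightarrow> bool" where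
  "smooth_on f S \<longleftrightarrow> (\<forall>k. Ck_on k f S)"

section \<open>Smooth manifolds\<close>

text \<open>A manifold is a second countable Hausdorff type with a smooth atlas modelled on
  \<open>real ^ 'd\<close>; its dimension is \<open>CARD('d)\<close>. A chart is a pair \<open>(U, \<phi>)\<close> of a domain and a
  coordinate map; the values of \<open>\<phi>\<close> outside \<open>U\<close> are irrelevant. The atlas need not be maximal:
  none of the notions below changes when compatible charts are added.\<close>

type_synonym ('a, 'd) chart = "'a set \<times> ('a \<Rightarrow> real ^ 'd)"

abbreviation cdom :: "('a, 'd::finite) chart \<Rightarrow> 'a set" where
  "cdom c \<equiv> fst c"

abbreviation cmap :: "('a, 'd::finite) chart \<Rightarrow> 'a \<Rightarrow> real ^ 'd" where
  "cmap c \<equiv> snd c"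

definition cinv :: "('a, 'd::finite) chart \<Rightarrow> real ^ 'd \<Rightarrow> 'a" where
  "cinv c = inv_into (cdom c) (cmap c)"

definition smooth_atlas ::
    "('a::{t2_space,second_countable_topology}, 'd::finite) chart set \<Rightarrow> bool" where
  "smooth_atlas A \<longleftrightarrow>
     (\<Union>c\<in>A. cdom c) = UNIV \<and>
     (\<forall>c\<in>A. open (cdom c) \<and> open (cmap c ` cdom c) \<and>
        homeomorphism (cdom c) (cmap c ` cdom c) (cmap c) (cinv c)) \<and>
     (\<forall>c\<in>A. \<forall>d\<in>A. smooth_on (cmap d \<circ> cinv c) (cmap c ` (cdom c \<inter> cdom d)))"

definition smooth_fun ::
    "('a::topological_space, 'd::finite) chart set \<Rightarrow> ('a \<Rightarrow> real) \<Rightarrow> bool" where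
  "smooth_fun A f \<longleftrightarrow> (\<forall>c\<in>A. smooth_on (f \<circ> cinv c) (cmap c ` cdom c))"

definition smooth_map ::
    "('a::topological_space, 'd::finite) chart set \<Rightarrow> ('b::topological_space, 'e::finite) chart set \<Rightarrow>
     ('a \<Rightarrow> 'b) \<Rightarrow> bool" where
  "smooth_map A B F \<longleftrightarrow>
     continuous_on UNIV F \<and>
     (\<forall>c\<in>A. \<forall>d\<in>B. smooth_on (cmap d \<circ> F \<circ> cinv c) (cmap c ` (cdom c \<inter> F -` cdom d)))"

section \<open>Tangent vectors\<close>

text \<open>A tangent vector at \<open>p\<close> is the family of its coordinate vectors in all charts around \<open>p\<close>,
  related by the derivatives of the transition maps, and extended by \<open>0\<close> to all other charts so
  that equality of tangent vectors is equality of functions. The vector space operations are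
  pointwise.\<close>

type_synonym ('a, 'd) tvec = "('a, 'd) chart \<Rightarrow> real ^ 'd"

definition charts_at :: "('a, 'd::finite) chart set \<Rightarrow> 'a \<Rightarrow> ('a, 'd) chart set" where
  "charts_at A p = {c \<in> A. p \<in> cdom c}"

definition tangent_space :: "('a, 'd::finite) chart set \<Rightarrow> 'a \<Rightarrow> ('a, 'd) tvec set" where
  "tangent_space A p = {v.
     (\<forall>c\<in>charts_at A p. \<forall>d\<in>charts_at A p.
        v d = frechet_derivative (cmap d \<circ> cinv c) (at (cmap c p)) (v c)) \<and>
     (\<forall>c. c \<notin> charts_at A p \<longrightarrow> v c = 0)}"

definition tzero :: "('a, 'd::finite) tvec" where
  "tzero = (\<lambda>_. 0)"

definition tadd :: "('a, 'd::finite) tvec \<Rightarrow> ('a, 'd) tvec \<Rightarrow> ('a, 'd) tvec" where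
  "tadd u v = (\<lambda>c. u c + v c)"

definition tscale :: "real \<Rightarrow> ('a, 'd::finite) tvec \<Rightarrow> ('a, 'd) tvec" where
  "tscale a v = (\<lambda>c. a *\<^sub>R v c)"

definition coord_vec ::
    "('a, 'd::finite) chart set \<Rightarrow> ('a, 'd) chart \<Rightarrow> 'a \<Rightarrow> 'd \<Rightarrow> ('a, 'd) tvec" where
  "coord_vec A c p i = (\<lambda>d. if d \<in> charts_at A p
     then frechet_derivative (cmap d \<circ> cinv c) (at (cmap c p)) (axis i 1) else 0)"

text \<open>By the chain rule the value of the differential on a tangent vector does not depend on the
  chart \<open>c\<close> chosen around \<open>p\<close>.\<close>

definition differential ::
    "('a, 'd::finite) chart set \<Rightarrow> ('b, 'e::finite) chart set \<Rightarrow> ('a \<Rightarrow> 'b) \<Rightarrow> 'a \<Rightarrow>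
     ('a, 'd) tvec \<Rightarrow> ('b, 'e) tvec" where
  "differential A B F p v = (\<lambda>d. if d \<in> charts_at B (F p)
     then (let c = (SOME c. c \<in> charts_at A p)
           in frechet_derivative (cmap d \<circ> F \<circ> cinv c) (at (cmap c p)) (v c))
     else 0)"

definition velocity :: "('a, 'd::finite) chart set \<Rightarrow> (real \<Rightarrow> 'a) \<Rightarrow> real \<Rightarrow> ('a, 'd) tvec" where
  "velocity A \<alpha> t = (\<lambda>c. if c \<in> charts_at A (\<alpha> t)
     then vector_derivative (cmap c \<circ> \<alpha>) (at t) else 0)"

section \<open>Riemannian metrics and geodesics\<close>

type_synonym ('a, 'd) metric = "'a \<Rightarrow> ('a, 'd) tvec \<Rightarrow> ('a, 'd) tvec \<Rightarrow> real"

definition metric_matrix ::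
    "('a, 'd::finite) chart set \<Rightarrow> ('a, 'd) metric \<Rightarrow> ('a, 'd) chart \<Rightarrow> real ^ 'd \<Rightarrow> real ^ 'd ^ 'd" where
  "metric_matrix A g c x =
     (\<chi> i j. g (cinv c x) (coord_vec A c (cinv c x) i) (coord_vec A c (cinv c x) j))"

definition riemannian_metric :: "('a, 'd::finite) chart set \<Rightarrow> ('a, 'd) metric \<Rightarrow> bool" where
  "riemannian_metric A g \<longleftrightarrow>
     (\<forall>p. \<forall>u\<in>tangent_space A p. \<forall>v\<in>tangent_space A p.
        g p u v = g p v u \<and>
        (\<forall>w\<in>tangent_space A p. g p (tadd u v) w = g p u w + g p v w) \<and>
        (\<forall>a. g p (tscale a u) v = a * g p u v) \<and>
        (u \<noteq> tzero \<longrightarrow> g p u u > 0)) \<and>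
     (\<forall>c\<in>A. \<forall>i j. smooth_on (\<lambda>x. metric_matrix A g c x $ i $ j) (cmap c ` cdom c))"

definition riemannian_manifold ::
    "('a::{t2_space,second_countable_topology}, 'd::finite) chart set \<Rightarrow> ('a, 'd) metric \<Rightarrow> bool" where
  "riemannian_manifold A g \<longleftrightarrow> smooth_atlas A \<and> riemannian_metric A g"

text \<open>The Christoffel symbols \<open>\<Gamma>\<^sup>k\<^sub>i\<^sub>j\<close> of the Levi-Civita connection in the chart \<open>c\<close>.\<close>

definition partial_deriv :: "'d::finite \<Rightarrow> (real ^ 'd \<Rightarrow> real) \<Rightarrow> real ^ 'd \<Rightarrow> real" where
  "partial_deriv i h x = frechet_derivative h (at x) (axis i 1)"

definition christoffel ::
    "('a, 'd::finite) chart set \<Rightarrow> ('a, 'd) metric \<Rightarrow> ('a, 'd) chart \<Rightarrow> real ^ 'd \<Rightarrow> 'd \<Rightarrow> 'd \<Rightarrow> 'd \<Rightarrow> real" where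
  "christoffel A g c x k i j = (\<Sum>l\<in>UNIV. matrix_inv (metric_matrix A g c x) $ k $ l *
     (partial_deriv i (\<lambda>y. metric_matrix A g c y $ j $ l) x
      + partial_deriv j (\<lambda>y. metric_matrix A g c y $ i $ l) x
      - partial_deriv l (\<lambda>y. metric_matrix A g c y $ i $ j) x)) / 2"

text \<open>Geodesics are parametrized by open intervals. Constant curves are included, so the
  parameter is an affine one, not necessarily arc length.\<close>

definition geodesic_on ::
    "('a::topological_space, 'd::finite) chart set \<Rightarrow> ('a, 'd) metric \<Rightarrow> real set \<Rightarrow> (real \<Rightarrow> 'a) \<Rightarrow> bool" where
  "geodesic_on A g I \<alpha> \<longleftrightarrow>
     open I \<and> is_interval I \<and> continuous_on I \<alpha> \<and>
     (\<forall>c\<in>A. smooth_on (cmap c \<circ> \<alpha>) (I \<inter> \<alpha> -` cdom c) \<and>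
        (\<forall>t\<in>I \<inter> \<alpha> -` cdom c. \<forall>k.
           vector_derivative (\<lambda>s. vector_derivative (cmap c \<circ> \<alpha>) (at s)) (at t) $ k
           + (\<Sum>i\<in>UNIV. \<Sum>j\<in>UNIV. christoffel A g c (cmap c (\<alpha> t)) k i j
                * vector_derivative (cmap c \<circ> \<alpha>) (at t) $ i
                * vector_derivative (cmap c \<circ> \<alpha>) (at t) $ j) = 0))"

section \<open>Clairaut conformal and Riemannian submersions\<close>

definition submersion ::
    "('a::topological_space, 'd::finite) chart set \<Rightarrow> ('b::topological_space, 'e::finite) chart set \<Rightarrow>
     ('a \<Rightarrow> 'b) \<Rightarrow> bool" where
  "submersion A B F \<longleftrightarrow>
     smooth_map A B F \<and>
     (\<forall>p. differential A B F p ` tangent_space A p = tangent_space B (F p))"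

definition vertical_space ::
    "('a, 'd::finite) chart set \<Rightarrow> ('b, 'e::finite) chart set \<Rightarrow> ('a \<Rightarrow> 'b) \<Rightarrow> 'a \<Rightarrow> ('a, 'd) tvec set" where
  "vertical_space A B F p = {v \<in> tangent_space A p. differential A B F p v = tzero}"

definition horizontal_space ::
    "('a, 'd::finite) chart set \<Rightarrow> ('a, 'd) metric \<Rightarrow> ('b, 'e::finite) chart set \<Rightarrow> ('a \<Rightarrow> 'b) \<Rightarrow> 'a \<Rightarrow>
     ('a, 'd) tvec set" where
  "horizontal_space A g B F p =
     {v \<in> tangent_space A p. \<forall>w\<in>vertical_space A B F p. g p v w = 0}"

definition conformal_submersion ::
    "('a::topological_space, 'd::finite) chart set \<Rightarrow> ('a, 'd) metric \<Rightarrow>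
     ('b::topological_space, 'e::finite) chart set \<Rightarrow> ('b, 'e) metric \<Rightarrow>
     ('a \<Rightarrow> 'b) \<Rightarrow> ('a \<Rightarrow> real) \<Rightarrow> bool" where
  "conformal_submersion A g B g' F dil \<longleftrightarrow>
     submersion A B F \<and> smooth_fun A dil \<and> (\<forall>p. dil p > 0) \<and>
     (\<forall>p. \<forall>X\<in>horizontal_space A g B F p. \<forall>Y\<in>horizontal_space A g B F p.
        g' (F p) (differential A B F p X) (differential A B F p Y) = (dil p)\<^sup>2 * g p X Y)"

definition riemannian_submersion ::
    "('a::topological_space, 'd::finite) chart set \<Rightarrow> ('a, 'd) metric \<Rightarrow>
     ('b::topological_space, 'e::finite) chart set \<Rightarrow> ('b, 'e) metric \<Rightarrow> ('a \<Rightarrow> 'b) \<Rightarrow> bool" where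
  "riemannian_submersion A g B g' F \<longleftrightarrow> conformal_submersion A g B g' F (\<lambda>_. 1)"

text \<open>The angle in \<open>[0, \<pi>/2]\<close> between a vector and a nonzero subspace: the smallest angle between
  \<open>v\<close> and a nonzero element of \<open>H\<close>. For \<open>v = tzero\<close> the totalized division gives \<open>\<pi>/2\<close>, which is
  harmless below: a geodesic with a zero velocity vector is constant, and then so is \<open>r\<close> along it.\<close>

definition angle_to_subspace ::
    "('a, 'd::finite) metric \<Rightarrow> 'a \<Rightarrow> ('a, 'd) tvec \<Rightarrow> ('a, 'd) tvec set \<Rightarrow> real" where
  "angle_to_subspace g p v H =
     (INF h\<in>H - {tzero}. arccos (g p v h / (sqrt (g p v v) * sqrt (g p h h))))"

definition clairaut_condition ::
    "('a::topological_space, 'd::finite) chart set \<Rightarrow> ('a, 'd) metric \<Rightarrow>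
     ('b::topological_space, 'e::finite) chart set \<Rightarrow> ('a \<Rightarrow> 'b) \<Rightarrow> ('a \<Rightarrow> real) \<Rightarrow> bool" where
  "clairaut_condition A g B F r \<longleftrightarrow>
     smooth_fun A r \<and> (\<forall>p. r p > 0) \<and>
     (\<forall>I \<alpha>. geodesic_on A g I \<alpha> \<longrightarrow>
        (\<lambda>t. r (\<alpha> t) * sin (angle_to_subspace g (\<alpha> t) (velocity A \<alpha> t)
                              (horizontal_space A g B F (\<alpha> t)))) constant_on I)"

definition clairaut_conformal_submersion ::
    "('a::topological_space, 'd::finite) chart set \<Rightarrow> ('a, 'd) metric \<Rightarrow>
     ('b::topological_space, 'e::finite) chart set \<Rightarrow> ('b, 'e) metric \<Rightarrow>
     ('a \<Rightarrow> 'b) \<Rightarrow> ('a \<Rightarrow> real) \<Rightarrow> ('a \<Rightarrow> real) \<Rightarrow> bool" where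
  "clairaut_conformal_submersion A g B g' F dil r \<longleftrightarrow>
     conformal_submersion A g B g' F dil \<and> clairaut_condition A g B F r"

definition clairaut_riemannian_submersion ::
    "('a::topological_space, 'd::finite) chart set \<Rightarrow> ('a, 'd) metric \<Rightarrow>
     ('b::topological_space, 'e::finite) chart set \<Rightarrow> ('b, 'e) metric \<Rightarrow>
     ('a \<Rightarrow> 'b) \<Rightarrow> ('a \<Rightarrow> real) \<Rightarrow> bool" where
  "clairaut_riemannian_submersion A g B g' F r \<longleftrightarrow>
     riemannian_submersion A g B g' F \<and> clairaut_condition A g B F r"

definition conformal_metric :: "('a \<Rightarrow> real) \<Rightarrow> ('a, 'd::finite) metric \<Rightarrow> ('a, 'd) metric" where
  "conformal_metric dil g = (\<lambda>p u v. (dil p)\<^sup>2 * g p u v)"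

end

theory Submission
  imports Defs
begin

text \<open>Conformal changes do not affect angles, so only the geodesics change. Put \<open>h = F\<^sup>*g'\<close> and
  \<open>N = \<lambda>\<^sup>2 g - h\<close>; then \<open>N(v, v)\<close> is \<open>\<lambda>\<^sup>2\<close> times the squared length of the vertical part of \<open>v\<close>, and
  \<open>sin\<^sup>2 \<omega> = N(v, v) / (\<lambda>\<^sup>2 g(v, v))\<close>. Since \<open>g(v, v)\<close> is constant along geodesics, the Clairaut relation
  says that \<open>Q = r\<^sup>2 N / \<lambda>\<^sup>2\<close> is a Killing tensor of \<open>g\<close>, and the claim is that \<open>\<lambda>\<^sup>4 Q\<close> is one of
  \<open>\<lambda>\<^sup>2 g\<close>. The difference of the two Levi-Civita connections produces a single extra term, a multiple
  of \<open>g(v, v) Q(v, \<nabla>\<lambda>)\<close>, so it remains to see that \<open>\<nabla>\<lambda>\<close> is horizontal. For this take a geodesic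
  that starts horizontally: its Clairaut constant is \<open>0\<close>, so it stays horizontal, and comparing its
  Euler--Lagrange equation for \<open>\<lambda>\<^sup>2 g\<close> with that for the pullback \<open>h\<close>, in the direction of a vertical
  vector \<open>V\<close>, leaves \<open>d\<lambda>(V) = 0\<close>. Both steps need a geodesic with given initial velocity.\<close>

section \<open>Calculus of maps of class \<open>C\<^sup>k\<close>\<close>

text \<open>The Clairaut relation is information along single geodesics, whereas a Killing equation
  and the horizontality of a gradient are pointwise in position and velocity; hence the local
  existence theorem for the geodesic equation, obtained here from the Banach fixed point theorem. No
  covariant derivative occurs. The geodesic equation is tested against a vector \<open>w\<close>,
  which lowers the index and turns it into \<open>euler_lagrange\<close>. This expression is linear
  in the metric, obeys a short rule when the metric is multiplied by a function, and is natural
  under every smooth map, injective or not. Naturality serves twice: for changes of charts, and for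
  \<open>F\<close>, where it removes the contribution of the pullback of \<open>g'\<close> in
  vertical directions. The weight \<lambda>^4 is forced: with it the Killing quantity divided by the
  energy \<lambda>^2 g(v, v) of the new metric is (\<lambda> r sin \<omega>)^2.\<close>

lemma Ck_on_SucD: "Ck_on (Suc k) f S \<Longrightarrow> Ck_on k f S"
proof (induction k arbitrary: f)
  case 0
  then have "f differentiable (at x within S)" if "x \<in> S" for x
    using that by (auto intro: differentiable_at_withinI)
  then show ?case
    using differentiable_imp_continuous_on[of f S] by (auto simp: differentiable_on_def)
next
  case (Suc k)
  then have "f differentiable (at x)" if "x \<in> S" for x
    using that unfolding Ck_on.simps(2)[of "Suc k"] by blast
  moreover have "Ck_on k (\<lambda>x. frechet_derivative f (at x) v) S" for v
    using Suc unfolding Ck_on.simps(2)[of "Suc k"] by blast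
  ultimately show ?case
    by simp
qed

lemma Ck_on_subset: "Ck_on k f T \<Longrightarrow> S \<subseteq> T \<Longrightarrow> Ck_on k f S"
  by (induction k arbitrary: f) (auto intro: continuous_on_subset)

lemma Ck_on_cong:
  assumes "open S" "\<And>x. x \<in> S \<Longrightarrow> f x = g x" "Ck_on k f S"
  shows "Ck_on k g S"
  using assms(2,3)
proof (induction k arbitrary: f g)
  case 0
  then show ?case
    using continuous_on_cong[of S S f g] by simp
next
  case (Suc k)
  have deriv: "(g has_derivative frechet_derivative f (at x)) (at x)" if "x \<in> S" for x
    using Suc.prems that assms(1)
    by (intro has_derivative_transform_within_open[of f _ x UNIV S g])
      (auto simp: frechet_derivative_works)
  have "Ck_on k (\<lambda>x. frechet_derivative g (at x) v) S" for v
    by (rule Suc.IH[of "\<lambda>x. frechet_derivative f (at x) v"])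
      (use Suc.prems deriv[THEN frechet_derivative_at] in \<open>simp_all\<close>)
  with deriv show ?case
    by (auto intro: differentiableI)
qed

text \<open>The recursion speaks of \<open>frechet_derivative\<close>, a choice term without a
  usable formula. By uniqueness of derivatives any explicit family \<open>D\<close> may replace it,
  which is how the closure properties below are proved.\<close>

lemma Ck_on_SucI:
  assumes "open S"
    and "\<And>x. x \<in> S \<Longrightarrow> (f has_derivative D x) (at x)"
    and "\<And>v. Ck_on k (\<lambda>x. D x v) S"
  shows "Ck_on (Suc k) f S"
proof -
  have "Ck_on k (\<lambda>x. frechet_derivative f (at x) v) S" for v
    by (rule Ck_on_cong[OF assms(1) _ assms(3)[of v]])
      (use assms(2) frechet_derivative_at in force)
  then show ?thesis
    using assms(2) by (auto intro: differentiableI)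
qed

lemma Ck_on_Suc_has_derivative:
  assumes "Ck_on (Suc k) f S" "x \<in> S"
  shows "(f has_derivative frechet_derivative f (at x)) (at x)"
  using assms by (simp add: frechet_derivative_works)

lemma Ck_on_const: "Ck_on k (\<lambda>x. c) S"
  by (induction k arbitrary: c) auto

lemma Ck_on_linear:
  assumes "bounded_linear L" "open S" "Ck_on k f S"
  shows "Ck_on k (\<lambda>x. L (f x)) S"
  using assms(3)
proof (induction k arbitrary: f)
  case 0
  then show ?case
    using assms(1) by (simp add: bounded_linear.continuous_on)
next
  case (Suc k)
  then show ?case
    by (intro Ck_on_SucI[OF assms(2), of _ "\<lambda>x v. L (frechet_derivative f (at x) v)"])
      (auto intro!: bounded_linear.has_derivative[OF assms(1)] Ck_on_Suc_has_derivative[where k = k])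
qed

lemma Ck_on_id: "Ck_on k (\<lambda>x. x) S"
  by (cases k) (auto simp: Ck_on_const)

lemma Ck_on_bounded_linear: "bounded_linear L \<Longrightarrow> open S \<Longrightarrow> Ck_on k L S"
  using Ck_on_linear[OF _ _ Ck_on_id] by blast

lemma Ck_on_add:
  assumes "open S" "Ck_on k f S" "Ck_on k g S"
  shows "Ck_on k (\<lambda>x. f x + g x) S"
  using assms(2,3)
proof (induction k arbitrary: f g)
  case 0
  then show ?case by (simp add: continuous_on_add)
next
  case (Suc k)
  then show ?case
    by (intro Ck_on_SucI[OF assms(1),
          of _ "\<lambda>x v. frechet_derivative f (at x) v + frechet_derivative g (at x) v"])
      (simp_all add: has_derivative_add Ck_on_Suc_has_derivative[OF Suc.prems(1)]
        Ck_on_Suc_has_derivative[OF Suc.prems(2)])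
qed

lemma Ck_on_sum:
  assumes "open S" "\<And>i. i \<in> A \<Longrightarrow> Ck_on k (f i) S"
  shows "Ck_on k (\<lambda>x. \<Sum>i\<in>A. f i x) S"
  using assms(2)
  by (induction A rule: infinite_finite_induct) (auto simp: Ck_on_const intro!: Ck_on_add assms(1))

text \<open>Both summands of the product rule are again values of \<open>bop\<close> on functions of
  class \<open>C\<^sup>k\<close>, so the induction closes. One statement covers scaling, products,
  inner products and matrix-vector products.\<close>

lemma Ck_on_bilinear:
  assumes "bounded_bilinear bop" "open S" "Ck_on k f S" "Ck_on k g S"
  shows "Ck_on k (\<lambda>x. bop (f x) (g x)) S"
  using assms(3,4)
proof (induction k arbitrary: f g)
  case 0
  then show ?case
    using bounded_bilinear.continuous_on[OF assms(1)] by auto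
next
  case (Suc k)
  show ?case
  proof (rule Ck_on_SucI[OF assms(2)])
    show "((\<lambda>x. bop (f x) (g x)) has_derivative
        (\<lambda>v. bop (f x) (frechet_derivative g (at x) v) + bop (frechet_derivative f (at x) v) (g x)))
        (at x)" if "x \<in> S" for x
      by (intro bounded_bilinear.FDERIV[OF assms(1)] Ck_on_Suc_has_derivative[OF Suc.prems(1) that]
          Ck_on_Suc_has_derivative[OF Suc.prems(2) that])
    show "Ck_on k (\<lambda>x. bop (f x) (frechet_derivative g (at x) v)
        + bop (frechet_derivative f (at x) v) (g x)) S" for v
      using Suc.prems Suc.prems[THEN Ck_on_SucD] by (intro Ck_on_add[OF assms(2)] Suc.IH) simp_all
  qed
qed

lemmas Ck_on_scaleR = Ck_on_bilinear[OF bounded_bilinear_scaleR]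
lemmas Ck_on_mult = Ck_on_bilinear[OF bounded_bilinear_mult]

lemma Ck_on_prod:
  fixes f :: "'i \<Rightarrow> 'a::real_normed_vector \<Rightarrow> real"
  assumes "open S" "\<And>i. i \<in> A \<Longrightarrow> Ck_on k (f i) S"
  shows "Ck_on k (\<lambda>x. \<Prod>i\<in>A. f i x) S"
  using assms(2)
  by (induction A rule: infinite_finite_induct) (auto simp: Ck_on_const intro!: Ck_on_mult assms(1))

lemma Ck_on_diff:
  assumes "open S" "Ck_on k f S" "Ck_on k g S"
  shows "Ck_on k (\<lambda>x. f x - g x) S"
  using Ck_on_add[OF assms(1,2) Ck_on_linear[OF bounded_linear_minus[OF bounded_linear_ident]
        assms(1,3)]]
  by simp

lemma Ck_on_inverse:
  fixes f :: "'a::real_normed_vector \<Rightarrow> real"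
  assumes "open S" "Ck_on k f S" "\<And>x. x \<in> S \<Longrightarrow> f x \<noteq> 0"
  shows "Ck_on k (\<lambda>x. inverse (f x)) S"
  using assms(2)
proof (induction k)
  case 0
  then show ?case
    using assms(3) by (auto intro: continuous_on_inverse)
next
  case (Suc k)
  show ?case
  proof (rule Ck_on_SucI[OF assms(1)])
    show "((\<lambda>x. inverse (f x)) has_derivative
        (\<lambda>v. (- 1) * (inverse (f x) * frechet_derivative f (at x) v * inverse (f x)))) (at x)"
      if "x \<in> S" for x
      using Deriv.has_derivative_inverse[OF assms(3)[OF that] Ck_on_Suc_has_derivative[OF Suc.prems that]]
      by simp
    show "Ck_on k (\<lambda>x. (- 1) * (inverse (f x) * frechet_derivative f (at x) v * inverse (f x))) S"
      for v
      using Suc Ck_on_SucD[OF Suc.prems] by (intro Ck_on_mult assms(1) Ck_on_const Suc.IH) simp_all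
  qed
qed

lemma Ck_on_euclideanI:
  fixes f :: "'a::real_normed_vector \<Rightarrow> 'b::euclidean_space"
  assumes "open S" "\<And>b. b \<in> Basis \<Longrightarrow> Ck_on k (\<lambda>x. f x \<bullet> b) S"
  shows "Ck_on k f S"
proof -
  have "Ck_on k (\<lambda>x. \<Sum>b\<in>Basis. (f x \<bullet> b) *\<^sub>R b) S"
    by (intro Ck_on_sum Ck_on_scaleR assms Ck_on_const)
  then show ?thesis
    by (simp add: euclidean_representation)
qed

lemma Ck_on_vecI:
  fixes f :: "'a::real_normed_vector \<Rightarrow> 'b::euclidean_space ^ 'n"
  assumes "open S" "\<And>i. Ck_on k (\<lambda>x. f x $ i) S"
  shows "Ck_on k f S"
proof (rule Ck_on_euclideanI[OF assms(1)])
  fix b :: "'b ^ 'n"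
  assume "b \<in> Basis"
  then obtain i b' where b: "b = axis i b'"
    by (auto simp: Basis_vec_def)
  have "Ck_on k (\<lambda>x. f x $ i \<bullet> b') S"
    by (rule Ck_on_linear[OF bounded_linear_inner_left assms(1,2)])
  then show "Ck_on k (\<lambda>x. f x \<bullet> b) S"
    by (simp add: b inner_axis)
qed

text \<open>The chain rule expression \<open>D g (f x) (D f x v)\<close> is not itself a
  composition, since the vector argument moves with \<open>x\<close>. Expanding that argument in the
  basis gives a sum of products of compositions, to which the induction hypothesis applies; hence
  the Euclidean middle space.\<close>

lemma Ck_on_compose:
  fixes f :: "'a::real_normed_vector \<Rightarrow> 'b::euclidean_space"
  assumes "open S" "Ck_on k g T" "Ck_on k f S" "f ` S \<subseteq> T"
  shows "Ck_on k (\<lambda>x. g (f x)) S"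
  using assms(2,3)
proof (induction k arbitrary: g)
  case 0
  then show ?case
    using assms(4) by (auto intro: continuous_on_compose2)
next
  case (Suc k)
  show ?case
  proof (rule Ck_on_SucI[OF assms(1)])
    fix x assume x: "x \<in> S"
    let ?D = "frechet_derivative g (at (f x))"
    have g: "(g has_derivative ?D) (at (f x))"
      using x assms(4) by (intro Ck_on_Suc_has_derivative[OF Suc.prems(1)]) auto
    have "linear ?D"
      using has_derivative_bounded_linear[OF g] bounded_linear.linear by blast
    then have "?D v = (\<Sum>b\<in>Basis. (v \<bullet> b) *\<^sub>R ?D b)" for v
      by (subst euclidean_representation[of v, symmetric]) (simp add: linear_sum linear_scale)
    then have D: "(\<lambda>v. ?D (frechet_derivative f (at x) v))
        = (\<lambda>v. \<Sum>b\<in>Basis. (frechet_derivative f (at x) v \<bullet> b) *\<^sub>R ?D b)"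
      by blast
    show "((\<lambda>x. g (f x)) has_derivative (\<lambda>v. \<Sum>b\<in>Basis. (frechet_derivative f (at x) v \<bullet> b) *\<^sub>R ?D b))
        (at x)"
      using has_derivative_compose[OF Ck_on_Suc_has_derivative[OF Suc.prems(2) x] g]
      unfolding D .
  next
    have "Ck_on k (\<lambda>x. frechet_derivative g (at (f x)) b) S" for b
      using Suc.prems(1) Ck_on_SucD[OF Suc.prems(2)] by (intro Suc.IH) simp_all
    moreover have "Ck_on k (\<lambda>x. frechet_derivative f (at x) v \<bullet> b) S" for b v
      using Suc.prems(2) by (intro Ck_on_linear[OF bounded_linear_inner_left assms(1)]) simp
    ultimately show "Ck_on k (\<lambda>x. \<Sum>b\<in>Basis. (frechet_derivative f (at x) v \<bullet> b)
        *\<^sub>R frechet_derivative g (at (f x)) b) S" for v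
      by (intro Ck_on_sum Ck_on_scaleR assms(1))
  qed
qed

lemma smooth_on_subset: "smooth_on f T \<Longrightarrow> S \<subseteq> T \<Longrightarrow> smooth_on f S"
  by (auto simp: smooth_on_def intro: Ck_on_subset)

lemma smooth_on_cong: "open S \<Longrightarrow> (\<And>x. x \<in> S \<Longrightarrow> f x = g x) \<Longrightarrow> smooth_on f S \<Longrightarrow> smooth_on g S"
  unfolding smooth_on_def using Ck_on_cong[of S f g] by blast

lemma smooth_on_const: "smooth_on (\<lambda>x. c) S"
  by (simp add: smooth_on_def Ck_on_const)

lemma smooth_on_compose:
  fixes f :: "'a::real_normed_vector \<Rightarrow> 'b::euclidean_space"
  shows "open S \<Longrightarrow> smooth_on g T \<Longrightarrow> smooth_on f S \<Longrightarrow> f ` S \<subseteq> T \<Longrightarrow> smooth_on (\<lambda>x. g (f x)) S"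
  by (auto simp: smooth_on_def intro: Ck_on_compose)

lemma smooth_on_mult:
  fixes f g :: "'a::real_normed_vector \<Rightarrow> real"
  shows "open S \<Longrightarrow> smooth_on f S \<Longrightarrow> smooth_on g S \<Longrightarrow> smooth_on (\<lambda>x. f x * g x) S"
  by (auto simp: smooth_on_def intro: Ck_on_mult)

lemma smooth_on_linear:
  "bounded_linear L \<Longrightarrow> open S \<Longrightarrow> smooth_on f S \<Longrightarrow> smooth_on (\<lambda>x. L (f x)) S"
  by (auto simp: smooth_on_def intro: Ck_on_linear)

lemma smooth_on_frechet_derivative: "smooth_on f S \<Longrightarrow> smooth_on (\<lambda>x. frechet_derivative f (at x) v) S"
  unfolding smooth_on_def using Ck_on.simps(2) by blast

lemma smooth_on_has_derivative:
  "smooth_on f S \<Longrightarrow> x \<in> S \<Longrightarrow> (f has_derivative frechet_derivative f (at x)) (at x)"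
  unfolding smooth_on_def using Ck_on_Suc_has_derivative by blast

lemma smooth_on_differentiable: "smooth_on f S \<Longrightarrow> x \<in> S \<Longrightarrow> f differentiable (at x)"
  using smooth_on_has_derivative by (auto intro: differentiableI)

section \<open>Symmetry of second derivatives\<close>

text \<open>The mean value theorem is used twice, first in direction \<open>u\<close> for the
  difference over \<open>s *\<^sub>R w\<close>, then in direction \<open>w\<close> for the
  derivative along \<open>u\<close>. The left-hand side is symmetric in \<open>u\<close> and
  \<open>w\<close>, the right-hand side not visibly so: this is the source of Schwarz's
  theorem.\<close>

lemma second_difference_eq:
  fixes f :: "'a::real_normed_vector \<Rightarrow> real"
  assumes f: "Ck_on 2 f S" and "s > 0"
    and S: "\<And>a b. 0 \<le> a \<Longrightarrow> a \<le> s \<Longrightarrow> 0 \<le> b \<Longrightarrow> b \<le> s \<Longrightarrow> x + a *\<^sub>R u + b *\<^sub>R w \<in> S"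
  obtains a b where "0 \<le> a" "a \<le> s" "0 \<le> b" "b \<le> s"
    "f (x + s *\<^sub>R u + s *\<^sub>R w) - f (x + s *\<^sub>R u) - (f (x + s *\<^sub>R w) - f x)
      = s\<^sup>2 * frechet_derivative (\<lambda>y. frechet_derivative f (at y) u) (at (x + a *\<^sub>R u + b *\<^sub>R w)) w"
proof -
  let ?D = "\<lambda>y. frechet_derivative f (at y)"
  let ?D2 = "\<lambda>y. frechet_derivative (\<lambda>y. ?D y u) (at y)"
  have f': "Ck_on (Suc (Suc 0)) f S"
    using f by (simp add: numeral_2_eq_2)
  have D: "(f has_derivative ?D y) (at y)" if "y \<in> S" for y
    using Ck_on_Suc_has_derivative[OF f' that] .
  have "Ck_on (Suc 0) (\<lambda>y. ?D y u) S"
    using f' by simp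
  then have D2: "((\<lambda>y. ?D y u) has_derivative ?D2 y) (at y)" if "y \<in> S" for y
    using Ck_on_Suc_has_derivative that by blast
  have scale: "?D y (r *\<^sub>R v) = r *\<^sub>R ?D y v" "?D2 y (r *\<^sub>R v) = r *\<^sub>R ?D2 y v" if "y \<in> S" for y r v
    using has_derivative_bounded_linear[OF D[OF that]] has_derivative_bounded_linear[OF D2[OF that]]
    by (simp_all add: linear_simps)
  define h where "h a = f (x + a *\<^sub>R u + s *\<^sub>R w) - f (x + a *\<^sub>R u)" for a
  have "DERIV h a :> ?D (x + a *\<^sub>R u + s *\<^sub>R w) u - ?D (x + a *\<^sub>R u) u" if "0 \<le> a" "a \<le> s" for a
  proof -
    have "x + a *\<^sub>R u + s *\<^sub>R w \<in> S" "x + a *\<^sub>R u \<in> S"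
      using S[of a s] S[of a 0] that \<open>s > 0\<close> by auto
    then show ?thesis
      unfolding h_def has_field_derivative_def
      by (auto intro!: derivative_eq_intros has_derivative_compose[OF _ D] simp: scale algebra_simps)
  qed
  from MVT2[OF \<open>s > 0\<close> this] obtain a where a: "0 < a" "a < s"
    and ha: "h s - h 0 = s * (?D (x + a *\<^sub>R u + s *\<^sub>R w) u - ?D (x + a *\<^sub>R u) u)"
    by auto
  have "DERIV (\<lambda>b. ?D (x + a *\<^sub>R u + b *\<^sub>R w) u) b :> ?D2 (x + a *\<^sub>R u + b *\<^sub>R w) w"
    if "0 \<le> b" "b \<le> s" for b
  proof -
    have "x + a *\<^sub>R u + b *\<^sub>R w \<in> S"
      using S[of a b] that a by auto
    note S' = this
    have "((\<lambda>b. x + a *\<^sub>R u + b *\<^sub>R w) has_derivative (\<lambda>r. r *\<^sub>R w)) (at b)"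
      by (auto intro!: derivative_eq_intros)
    from has_derivative_compose[OF this D2[OF S']] show ?thesis
      by (simp add: has_field_derivative_def scale[OF S'] mult_commute_abs)
  qed
  from MVT2[OF \<open>s > 0\<close> this] obtain b where b: "0 < b" "b < s"
    and hb: "?D (x + a *\<^sub>R u + s *\<^sub>R w) u - ?D (x + a *\<^sub>R u) u = s * ?D2 (x + a *\<^sub>R u + b *\<^sub>R w) w"
    by auto
  show ?thesis
    by (rule that[of a b]) (use a b ha hb in \<open>auto simp: h_def power2_eq_square\<close>)
qed

text \<open>Both orders of \<open>u\<close> and \<open>w\<close> give the same second difference, so
  the two mixed derivatives agree at two points of a small parallelogram; continuity carries this to
  \<open>x\<close> up to any \<open>e\<close>.\<close>

lemma second_derivative_symmetric_real:
  fixes f :: "'a::real_normed_vector \<Rightarrow> real"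
  assumes "open S" and f: "Ck_on 2 f S" and "x \<in> S"
  shows "frechet_derivative (\<lambda>y. frechet_derivative f (at y) u) (at x) w
    = frechet_derivative (\<lambda>y. frechet_derivative f (at y) w) (at x) u"
proof -
  define D2 where "D2 y u w = frechet_derivative (\<lambda>y. frechet_derivative f (at y) u) (at y) w" for y u w
  have cont: "continuous_on S (\<lambda>y. D2 y u w)" for u w
    using f by (simp add: numeral_2_eq_2 D2_def)
  have "\<bar>D2 x u w - D2 x w u\<bar> \<le> e" if "e > 0" for e
  proof -
    have tendsto: "((\<lambda>y. D2 y u w) \<longlongrightarrow> D2 x u w) (at x)" for u w
      using cont[of u w] assms(1,3) by (simp add: continuous_on_eq_continuous_at isCont_def)
    have "\<forall>\<^sub>F y in at x. dist (D2 y u w) (D2 x u w) < e / 2"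
      "\<forall>\<^sub>F y in at x. dist (D2 y w u) (D2 x w u) < e / 2"
      using tendstoD[OF tendsto, of "e / 2"] that by simp_all
    moreover have "\<forall>\<^sub>F y in at x. y \<in> S"
      using assms(1,3) by (rule eventually_at_in_open')
    ultimately have "\<forall>\<^sub>F y in at x. y \<in> S \<and> dist (D2 y u w) (D2 x u w) < e / 2
        \<and> dist (D2 y w u) (D2 x w u) < e / 2"
      by eventually_elim auto
    then obtain d where "d > 0" and "\<And>y. y \<noteq> x \<Longrightarrow> dist y x < d \<Longrightarrow> y \<in> S
        \<and> dist (D2 y u w) (D2 x u w) < e / 2 \<and> dist (D2 y w u) (D2 x w u) < e / 2"
      by (auto simp: eventually_at)
    then have d: "y \<in> S" "dist (D2 y u w) (D2 x u w) < e / 2" "dist (D2 y w u) (D2 x w u) < e / 2"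
      if "dist y x < d" for y
      using that assms(3) \<open>e > 0\<close> by (cases "y = x"; auto)+
    \<comment> \<open>This keeps the parallelogram spanned by \<open>s *\<^sub>R u\<close> and
      \<open>s *\<^sub>R w\<close> inside the ball of radius \<open>d\<close>; the summand 1 covers
      \<open>u = w = 0\<close>.\<close>
    define s where "s = d / (2 * (norm u + norm w + 1))"
    have "s > 0"
      using \<open>d > 0\<close> by (auto simp: s_def intro!: divide_pos_pos add_nonneg_pos)
    have close: "dist (x + a *\<^sub>R u + b *\<^sub>R w) x < d" if "0 \<le> a" "a \<le> s" "0 \<le> b" "b \<le> s" for a b
    proof -
      have "dist (x + a *\<^sub>R u + b *\<^sub>R w) x \<le> a * norm u + b * norm w"
        using norm_triangle_ineq[of "a *\<^sub>R u" "b *\<^sub>R w"] that by (simp add: dist_norm algebra_simps)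
      also have "\<dots> \<le> s * norm u + s * norm w"
        using that by (intro add_mono mult_right_mono) auto
      also have "\<dots> \<le> s * (norm u + norm w + 1)"
        using \<open>s > 0\<close> by (simp add: algebra_simps)
      also have "\<dots> = d / 2"
        unfolding s_def by (simp add: field_simps add_nonneg_eq_0_iff add_pos_nonneg)
      finally show ?thesis
        using \<open>d > 0\<close> by simp
    qed
    obtain a b where ab: "0 \<le> a" "a \<le> s" "0 \<le> b" "b \<le> s"
      "f (x + s *\<^sub>R u + s *\<^sub>R w) - f (x + s *\<^sub>R u) - (f (x + s *\<^sub>R w) - f x)
        = s\<^sup>2 * D2 (x + a *\<^sub>R u + b *\<^sub>R w) u w"
      unfolding D2_def by (rule second_difference_eq[OF f \<open>s > 0\<close>, of x u w]) (use close d in blast)+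
    obtain a' b' where ab': "0 \<le> a'" "a' \<le> s" "0 \<le> b'" "b' \<le> s"
      "f (x + s *\<^sub>R w + s *\<^sub>R u) - f (x + s *\<^sub>R w) - (f (x + s *\<^sub>R u) - f x)
        = s\<^sup>2 * D2 (x + a' *\<^sub>R w + b' *\<^sub>R u) w u"
      unfolding D2_def
      by (rule second_difference_eq[OF f \<open>s > 0\<close>, of x w u])
        (use close d in \<open>auto simp: add.assoc add.commute[of "_ *\<^sub>R w"]\<close>)
    have swap: "x + r *\<^sub>R w + r' *\<^sub>R u = x + r' *\<^sub>R u + r *\<^sub>R w" for r r'
      by simp
    have "s\<^sup>2 * D2 (x + a *\<^sub>R u + b *\<^sub>R w) u w = s\<^sup>2 * D2 (x + b' *\<^sub>R u + a' *\<^sub>R w) w u"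
      using ab(5) ab'(5)[unfolded swap[of s s] swap[of a' b']] by linarith
    then have "D2 (x + a *\<^sub>R u + b *\<^sub>R w) u w = D2 (x + b' *\<^sub>R u + a' *\<^sub>R w) w u"
      using \<open>s > 0\<close> by simp
    moreover have "dist (D2 (x + a *\<^sub>R u + b *\<^sub>R w) u w) (D2 x u w) < e / 2"
      using d(2) close ab by blast
    moreover have "dist (D2 (x + b' *\<^sub>R u + a' *\<^sub>R w) w u) (D2 x w u) < e / 2"
      using d(3) close ab' by blast
    ultimately show ?thesis
      unfolding dist_real_def by argo
  qed
  from field_le_epsilon[of _ 0, simplified, OF this] show ?thesis
    by (simp add: D2_def)
qed

lemma frechet_derivative_inner_left:
  assumes "f differentiable (at x)"
  shows "frechet_derivative (\<lambda>y. f y \<bullet> b) (at x) v = frechet_derivative f (at x) v \<bullet> b"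
  using frechet_derivative_at[OF has_derivative_inner_left[OF assms[unfolded frechet_derivative_works]]]
  by metis

lemma second_derivative_symmetric:
  fixes f :: "'a::real_normed_vector \<Rightarrow> 'b::euclidean_space"
  assumes "open S" and f: "smooth_on f S" and "x \<in> S"
  shows "frechet_derivative (\<lambda>y. frechet_derivative f (at y) u) (at x) w
    = frechet_derivative (\<lambda>y. frechet_derivative f (at y) w) (at x) u"
proof (rule euclidean_eqI)
  fix b :: 'b
  have D2: "frechet_derivative (\<lambda>y. frechet_derivative f (at y) u) (at x) w \<bullet> b
      = frechet_derivative (\<lambda>y. frechet_derivative (\<lambda>y. f y \<bullet> b) (at y) u) (at x) w" for u w
  proof -
    have "(\<lambda>y. frechet_derivative f (at y) u) differentiable (at x)"
      using smooth_on_differentiable[OF smooth_on_frechet_derivative[OF f] \<open>x \<in> S\<close>] .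
    moreover from this have "(\<lambda>y. frechet_derivative f (at y) u \<bullet> b) differentiable (at x)"
      by simp
    moreover have "frechet_derivative (\<lambda>y. f y \<bullet> b) (at y) u = frechet_derivative f (at y) u \<bullet> b"
      if "y \<in> S" for y
      using frechet_derivative_inner_left smooth_on_differentiable[OF f that] by blast
    ultimately show ?thesis
      using frechet_derivative_transform_within_open[of "\<lambda>y. frechet_derivative f (at y) u \<bullet> b" x S
          "\<lambda>y. frechet_derivative (\<lambda>y. f y \<bullet> b) (at y) u"] assms(1,3)
        frechet_derivative_inner_left[of "\<lambda>y. frechet_derivative f (at y) u" x b w]
      by simp
  qed
  have "Ck_on 2 (\<lambda>y. f y \<bullet> b) S"
    using f by (intro Ck_on_linear[OF bounded_linear_inner_left assms(1)]) (simp add: smooth_on_def)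
  from second_derivative_symmetric_real[OF assms(1) this assms(3)]
  show "frechet_derivative (\<lambda>y. frechet_derivative f (at y) u) (at x) w \<bullet> b
      = frechet_derivative (\<lambda>y. frechet_derivative f (at y) w) (at x) u \<bullet> b"
    by (simp add: D2)
qed

section \<open>Local solutions of ordinary differential equations\<close>

text \<open>Picard iteration, run as a contraction of the complete space of bounded continuous
  functions on the whole line. Clamping the time to [-e, e] turns the iterate into an element of
  that space.\<close>

lemma lipschitz_ode_solution:
  fixes \<Psi> :: "'a::euclidean_space \<Rightarrow> 'a"
  assumes lipschitz: "\<And>x y. dist (\<Psi> x) (\<Psi> y) \<le> L * dist x y" and "L \<ge> 0"
  obtains e z where "e > 0" "z 0 = z0"
    "\<And>t. t \<in> {-e<..<e} \<Longrightarrow> (z has_vector_derivative \<Psi> (z t)) (at t)"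
proof -
  \<comment> \<open>The iterate involves two integrals over intervals of length at most 2e, so the
    Lipschitz factor is 4eL, and this choice makes it at most 1/2, also for
    \<open>L = 0\<close>.\<close>
  define e where "e = 1 / (8 * (L + 1))"
  have e: "e > 0" "4 * e * L \<le> 1 / 2" "0 \<le> 4 * e * L"
    using \<open>L \<ge> 0\<close> by (auto simp: e_def field_simps)
  have "L-lipschitz_on UNIV \<Psi>"
    using lipschitz \<open>L \<ge> 0\<close> by (auto intro: lipschitz_onI)
  then have cont\<Psi>: "continuous_on UNIV \<Psi>"
    by (rule lipschitz_on_continuous_on)
  have cont: "continuous_on A (\<lambda>s. \<Psi> (apply_bcontfun z s))" for A and z :: "real \<Rightarrow>\<^sub>C 'a"
    by (rule continuous_on_compose2[OF cont\<Psi>]) auto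
  \<comment> \<open>Integrals over \<open>{a..b}\<close> are not oriented; the difference of two
    integrals from -e is the signed integral from 0 to \<open>t\<close>, also for negative
    \<open>t\<close>.\<close>
  define P where "P z t = z0 + (integral {-e..t} (\<lambda>s. \<Psi> (apply_bcontfun z s))
      - integral {-e..0} (\<lambda>s. \<Psi> (apply_bcontfun z s)))" for z :: "real \<Rightarrow>\<^sub>C 'a" and t
  have P': "(P z has_vector_derivative \<Psi> (apply_bcontfun z t)) (at t within {-e..e})"
    if "t \<in> {-e..e}" for z t
    unfolding P_def using integral_has_vector_derivative[OF cont that]
    by (auto intro!: derivative_eq_intros)
  have "continuous_on {-e..e} (P z)" for z
    using has_vector_derivative_continuous[OF P'] by (simp add: continuous_on_eq_continuous_within)
  then have "\<exists>T :: real \<Rightarrow>\<^sub>C 'a. \<forall>t. apply_bcontfun T t = P z (clamp (-e) e t)" for z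
    using continuous_on_cbox_bcontfunE[of "-e" e "P z"] by (metis cbox_interval)
  then obtain T :: "(real \<Rightarrow>\<^sub>C 'a) \<Rightarrow> real \<Rightarrow>\<^sub>C 'a"
    where T: "\<And>z t. apply_bcontfun (T z) t = P z (clamp (-e) e t)"
    by metis
  have "dist (T z) (T w) \<le> 1 / 2 * dist z w" for z w
  proof (rule dist_bound)
    fix t
    let ?c = "clamp (-e) e t"
    have c: "?c \<in> {-e..e}"
      using clamp_in_interval[of "-e" e t] e(1) by simp
    have diff: "norm (integral {-e..r} (\<lambda>s. \<Psi> (apply_bcontfun z s)) - integral {-e..r} (\<lambda>s. \<Psi> (apply_bcontfun w s)))
        \<le> L * dist z w * (2 * e)" if "r \<in> {-e..e}" for r
    proof -
      have "norm (integral {-e..r} (\<lambda>s. \<Psi> (apply_bcontfun z s) - \<Psi> (apply_bcontfun w s)))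
          \<le> L * dist z w * (r - - e)"
      proof (rule integral_bound)
        fix s
        have "L * dist (apply_bcontfun z s) (apply_bcontfun w s) \<le> L * dist z w"
          using \<open>L \<ge> 0\<close> by (intro mult_left_mono dist_bounded)
        with lipschitz[of "apply_bcontfun z s" "apply_bcontfun w s"]
        show "norm (\<Psi> (apply_bcontfun z s) - \<Psi> (apply_bcontfun w s)) \<le> L * dist z w"
          by (simp add: dist_norm)
      qed (use that in \<open>auto intro!: continuous_intros cont\<close>)
      also have "\<dots> \<le> L * dist z w * (2 * e)"
        using that \<open>L \<ge> 0\<close> by (intro mult_left_mono) auto
      finally show ?thesis
        by (subst (asm) integral_diff) (auto intro!: integrable_continuous_real cont)
    qed
    have "dist (P z ?c) (P w ?c) \<le> L * dist z w * (2 * e) + L * dist z w * (2 * e)"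
      using norm_triangle_le_diff[OF add_mono[OF diff[OF c] diff[of 0]]] e(1)
      by (simp add: P_def dist_norm algebra_simps)
    also have "\<dots> = 4 * e * L * dist z w"
      by simp
    also have "\<dots> \<le> 1 / 2 * dist z w"
      using e by (intro mult_right_mono) auto
    finally show "dist (apply_bcontfun (T z) t) (apply_bcontfun (T w) t) \<le> 1 / 2 * dist z w"
      by (simp add: T)
  qed
  then obtain z where z: "T z = z"
    using banach_fix_type[of "1 / 2" T] by auto
  have eq: "P z t = apply_bcontfun z t" if "t \<in> {-e..e}" for t
    using T[of z t] that by (simp add: z)
  have "(P z has_vector_derivative \<Psi> (P z t)) (at t)" if t: "t \<in> {-e<..<e}" for t
  proof -
    have "(P z has_vector_derivative \<Psi> (apply_bcontfun z t)) (at t within {-e<..<e})"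
      by (rule has_vector_derivative_within_subset[OF P']) (use t in auto)
    then show ?thesis
      using t eq[of t] at_within_open[of t "{-e<..<e}"] by simp
  qed
  moreover have "P z 0 = z0"
    by (simp add: P_def)
  ultimately show ?thesis
    using e(1) by (intro that[of e "P z"]) simp_all
qed

text \<open>\<open>Ck_on\<close> gives continuity of the derivative only in each fixed direction.
  The sum of the norms over the basis directions is therefore continuous, it dominates the operator
  norm, and it is bounded on the compact ball.\<close>

lemma C1_lipschitz_on_cball:
  fixes f :: "'a::euclidean_space \<Rightarrow> 'b::real_normed_vector"
  assumes f: "Ck_on 1 f S" and S: "cball z0 r \<subseteq> S"
  obtains L where "L \<ge> 0" "\<And>x y. x \<in> cball z0 r \<Longrightarrow> y \<in> cball z0 r \<Longrightarrow> dist (f x) (f y) \<le> L * dist x y"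
proof -
  let ?D = "\<lambda>x. frechet_derivative f (at x)"
  have D: "(f has_derivative ?D x) (at x)" if "x \<in> cball z0 r" for x
    using Ck_on_Suc_has_derivative[of 0 f S x] f S that by auto
  have "continuous_on (cball z0 r) (\<lambda>x. \<Sum>b\<in>Basis. norm (?D x b))"
    using f S by (intro continuous_intros) (auto intro: continuous_on_subset)
  then have "bounded ((\<lambda>x. \<Sum>b\<in>Basis. norm (?D x b)) ` cball z0 r)"
    by (intro compact_imp_bounded compact_continuous_image) auto
  then obtain L where "L > 0" "\<forall>x\<in>cball z0 r. norm (\<Sum>b\<in>Basis. norm (?D x b)) \<le> L"
    by (auto simp: bounded_pos)
  then have L: "L > 0" "\<And>x. x \<in> cball z0 r \<Longrightarrow> (\<Sum>b\<in>Basis. norm (?D x b)) \<le> L"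
    by (simp_all add: abs_le_iff)
  have bound: "norm (?D x v) \<le> L * norm v" if x: "x \<in> cball z0 r" for x v
  proof -
    have "linear (?D x)"
      using has_derivative_bounded_linear[OF D[OF x]] bounded_linear.linear by blast
    then have "norm (?D x v) = norm (\<Sum>b\<in>Basis. (v \<bullet> b) *\<^sub>R ?D x b)"
      using linear_sum[of "?D x" "\<lambda>b. (v \<bullet> b) *\<^sub>R b" Basis]
      by (simp add: linear_scale euclidean_representation)
    also have "\<dots> \<le> (\<Sum>b\<in>Basis. norm v * norm (?D x b))"
      by (rule sum_norm_le) (auto intro!: mult_right_mono simp: Basis_le_norm)
    also have "\<dots> \<le> L * norm v"
      using mult_left_mono[OF L(2)[OF x], of "norm v"] by (simp add: sum_distrib_left mult.commute)
    finally show ?thesis .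
  qed
  have "norm (f x - f y) \<le> L * norm (x - y)" if "x \<in> cball z0 r" "y \<in> cball z0 r" for x y
    by (rule differentiable_bound[OF convex_cball has_derivative_at_withinI[OF D] onorm_le[OF bound]])
      (use that in auto)
  with L(1) show ?thesis
    by (intro that[of L]) (auto simp: dist_norm)
qed

text \<open>Composing the vector field with the nearest-point projection onto a closed ball makes it
  globally Lipschitz. The solution starts at the centre, so for a short time it stays in the ball,
  where the projection is the identity.\<close>

lemma ode_solution:
  fixes \<Phi> :: "'a::euclidean_space \<Rightarrow> 'a"
  assumes "open S" "z0 \<in> S" "Ck_on 1 \<Phi> S"
  obtains e z where "e > 0" "z 0 = z0"
    "\<And>t. t \<in> {-e<..<e} \<Longrightarrow> z t \<in> S \<and> (z has_vector_derivative \<Phi> (z t)) (at t)"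
proof -
  obtain r where r: "r > 0" "cball z0 r \<subseteq> S"
    using assms open_contains_cball by metis
  obtain L where L: "L \<ge> 0"
    "\<And>x y. x \<in> cball z0 r \<Longrightarrow> y \<in> cball z0 r \<Longrightarrow> dist (\<Phi> x) (\<Phi> y) \<le> L * dist x y"
    using C1_lipschitz_on_cball[OF assms(3) r(2)] by metis
  let ?c = "closest_point (cball z0 r)"
  have c: "?c x \<in> cball z0 r" for x
    using r(1) by (intro closest_point_in_set) auto
  have "dist (\<Phi> (?c x)) (\<Phi> (?c y)) \<le> L * dist x y" for x y
  proof -
    have "dist (?c x) (?c y) \<le> dist x y"
      using r(1) by (intro closest_point_lipschitz) auto
    then show ?thesis
      using L(2)[OF c c, of x y] mult_left_mono[OF _ L(1)] by fastforce
  qed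
  from lipschitz_ode_solution[OF this L(1)]
  obtain e z where e: "e > 0" and z: "z 0 = z0"
    and z': "\<And>t. t \<in> {-e<..<e} \<Longrightarrow> (z has_vector_derivative \<Phi> (?c (z t))) (at t)"
    by metis
  have "isCont z 0"
    using z'[of 0] e has_vector_derivative_continuous by force
  then obtain d where d: "d > 0" "\<And>t. \<bar>t\<bar> < d \<Longrightarrow> dist (z t) z0 < r"
    using r(1) z unfolding continuous_at_eps_delta by (metis dist_real_def diff_zero)
  have "z t \<in> S \<and> (z has_vector_derivative \<Phi> (z t)) (at t)" if "t \<in> {- min d e<..<min d e}" for t
  proof -
    have "z t \<in> cball z0 r"
      using d(2)[of t] that by (auto simp: dist_commute less_imp_le)
    then show ?thesis
      using z'[of t] that r(2) by (auto simp: closest_point_self)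
  qed
  then show ?thesis
    using d(1) e z by (intro that[of "min d e" z]) simp_all
qed

lemma smooth_on_ode_solution:
  fixes \<Phi> :: "'a::euclidean_space \<Rightarrow> 'a"
  assumes "open J" "smooth_on \<Phi> S"
    and z: "\<And>t. t \<in> J \<Longrightarrow> z t \<in> S \<and> (z has_vector_derivative \<Phi> (z t)) (at t)"
  shows "smooth_on z J"
proof -
  have "Ck_on k z J" for k
  proof (induction k)
    case 0
    have "continuous (at t within J) z" if "t \<in> J" for t
      using z[OF that] has_vector_derivative_continuous continuous_at_imp_continuous_within by blast
    then show ?case
      by (simp add: continuous_on_eq_continuous_within)
  next
    case (Suc k)
    show ?case
    proof (rule Ck_on_SucI[OF assms(1)])
      show "(z has_derivative (\<lambda>s. s *\<^sub>R \<Phi> (z t))) (at t)" if "t \<in> J" for t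
        using z[OF that] by (simp add: has_vector_derivative_def)
      have "Ck_on k (\<lambda>t. \<Phi> (z t)) J"
        using assms(2) z by (intro Ck_on_compose[OF assms(1) _ Suc]) (auto simp: smooth_on_def)
      then show "Ck_on k (\<lambda>t. s *\<^sub>R \<Phi> (z t)) J" for s
        by (intro Ck_on_scaleR assms(1) Ck_on_const)
    qed
  qed
  then show ?thesis
    by (simp add: smooth_on_def)
qed

section \<open>Quadratic forms and Euler--Lagrange expressions\<close>

abbreviation D :: "('a::real_normed_vector \<Rightarrow> 'b::real_normed_vector) \<Rightarrow> 'a \<Rightarrow> 'a \<Rightarrow> 'b" where
  "D f x \<equiv> frechet_derivative f (at x)"

abbreviation form :: "real ^ 'd ^ 'd \<Rightarrow> real ^ 'd \<Rightarrow> real ^ 'd \<Rightarrow> real" where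
  "form A u v \<equiv> u \<bullet> (A *v v)"

lemma bounded_bilinear_matrix_vector_mult:
  "bounded_bilinear (\<lambda>(A :: real ^ 'm ^ 'n) v. A *v v)"
  unfolding bilinear_conv_bounded_bilinear[symmetric] bilinear_def
  by (auto intro!: linearI simp: algebra_simps scaleR_matrix_vector_assoc)

lemma has_derivative_form:
  assumes "(A has_derivative A') (at x)" "(u has_derivative u') (at x)" "(v has_derivative v') (at x)"
  shows "((\<lambda>x. form (A x) (u x) (v x)) has_derivative
    (\<lambda>h. form (A x) (u' h) (v x) + form (A' h) (u x) (v x) + form (A x) (u x) (v' h))) (at x)"
proof -
  have "((\<lambda>x. A x *v v x) has_derivative (\<lambda>h. A x *v v' h + A' h *v v x)) (at x)"
    using bounded_bilinear.FDERIV[OF bounded_bilinear_matrix_vector_mult assms(1,3)] .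
  from has_derivative_inner[OF assms(2) this] show ?thesis
    by (simp add: inner_add_right algebra_simps)
qed

lemma has_real_derivative_form:
  assumes "(A has_derivative A') (at (x t))" "(x has_vector_derivative x') (at t)"
    and "(u has_vector_derivative u') (at t)" "(v has_vector_derivative v') (at t)"
  shows "((\<lambda>s. form (A (x s)) (u s) (v s)) has_real_derivative
    form (A (x t)) u' (v t) + form (A' x') (u t) (v t) + form (A (x t)) (u t) v') (at t)"
proof -
  have "linear A'"
    using has_derivative_bounded_linear[OF assms(1)] bounded_linear.linear by blast
  moreover have "((\<lambda>s. A (x s)) has_derivative (\<lambda>h. A' (h *\<^sub>R x'))) (at t)"
    using has_derivative_compose[OF assms(2)[unfolded has_vector_derivative_def] assms(1)] .
  moreover from has_derivative_form[OF this assms(3,4)[unfolded has_vector_derivative_def]]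
  have "((\<lambda>s. form (A (x s)) (u s) (v s)) has_derivative
      (\<lambda>h. form (A (x t)) (h *\<^sub>R u') (v t) + form (A' (h *\<^sub>R x')) (u t) (v t)
        + form (A (x t)) (u t) (h *\<^sub>R v'))) (at t)" .
  ultimately show ?thesis
    by (simp add: has_real_derivative_iff_has_vector_derivative has_vector_derivative_def linear_scale
        scaleR_matrix_vector_assoc[symmetric] matrix_vector_mult_scaleR distrib_left)
qed

lemma form_commute: "transpose A = A \<Longrightarrow> form A u v = form A v u"
  by (metis dot_lmul_matrix inner_commute transpose_matrix_vector)

text \<open>For \<open>G\<close> the matrix of a metric, vanishing of this expression for all \<open>w\<close> is the geodesic
  equation for position \<open>x\<close>, velocity \<open>u\<close> and acceleration \<open>a\<close>, with lowered index: it is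
  \<open>d/dt G(u, w) - dG(w)(u, u) / 2\<close>.\<close>

definition euler_lagrange :: "(real ^ 'd \<Rightarrow> real ^ 'd ^ 'd) \<Rightarrow> real ^ 'd \<Rightarrow> real ^ 'd \<Rightarrow> real ^ 'd \<Rightarrow>
    real ^ 'd \<Rightarrow> real" where
  "euler_lagrange G x u a w = form (G x) w a + form (D G x u) u w - form (D G x w) u u / 2"

lemma euler_lagrange_cong:
  assumes "open S" "x \<in> S" "\<And>y. y \<in> S \<Longrightarrow> G y = H y" "G differentiable (at x)"
  shows "euler_lagrange G x = euler_lagrange H x"
proof -
  have "D G x = D H x"
    by (rule frechet_derivative_transform_within_open[OF assms(4,1,2,3)])
  with assms(2,3) show ?thesis
    by (auto simp: euler_lagrange_def fun_eq_iff)
qed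

lemma euler_lagrange_diff:
  assumes "G differentiable (at x)" "H differentiable (at x)"
  shows "euler_lagrange (\<lambda>y. G y - H y) x u a w = euler_lagrange G x u a w - euler_lagrange H x u a w"
proof -
  have "D (\<lambda>y. G y - H y) x = (\<lambda>v. D G x v - D H x v)"
    using assms unfolding frechet_derivative_works
    by (intro frechet_derivative_at[symmetric] has_derivative_diff)
  then show ?thesis
    by (simp add: euler_lagrange_def algebra_simps inner_diff_right diff_divide_distrib)
qed

lemma D_scaleR:
  assumes "s differentiable (at x)" "G differentiable (at x)"
  shows "D (\<lambda>y. s y *\<^sub>R G y) x v = s x *\<^sub>R D G x v + D s x v *\<^sub>R G x"
proof -
  have "((\<lambda>y. s y *\<^sub>R G y) has_derivative (\<lambda>v. s x *\<^sub>R D G x v + D s x v *\<^sub>R G x)) (at x)"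
    using assms unfolding frechet_derivative_works by (rule has_derivative_scaleR)
  from frechet_derivative_at[OF this] show ?thesis
    by metis
qed

text \<open>This is the conformal change of the Levi-Civita connection with lowered index: the two
  extra terms are the whole difference between the geodesic equations of \<open>G\<close> and
  \<open>s G\<close>.\<close>

lemma euler_lagrange_scaleR:
  assumes "s differentiable (at x)" "G differentiable (at x)"
  shows "euler_lagrange (\<lambda>y. s y *\<^sub>R G y) x u a w
    = s x * euler_lagrange G x u a w + D s x u * form (G x) u w - D s x w * form (G x) u u / 2"
  unfolding euler_lagrange_def D_scaleR[OF assms]
  by (simp add: matrix_vector_mult_add_rdistrib scaleR_matrix_vector_assoc[symmetric]
      inner_add_right algebra_simps diff_divide_distrib add_divide_distrib)

section \<open>Pullbacks of metrics and naturality of the Euler--Lagrange expression\<close>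

definition pullback :: "(real ^ 'd \<Rightarrow> real ^ 'e) \<Rightarrow> (real ^ 'e \<Rightarrow> real ^ 'e ^ 'e) \<Rightarrow> real ^ 'd \<Rightarrow>
    real ^ 'd ^ 'd" where
  "pullback \<phi> A y = (\<chi> i j. form (A (\<phi> y)) (D \<phi> y (axis i 1)) (D \<phi> y (axis j 1)))"

lemma linear_axis_expansion:
  fixes f :: "real ^ 'd \<Rightarrow> 'b::real_vector"
  assumes "linear f"
  shows "f v = (\<Sum>i\<in>UNIV. v $ i *\<^sub>R f (axis i 1))"
proof -
  have "f v = f (\<Sum>i\<in>UNIV. v $ i *\<^sub>R axis i 1)"
    using basis_expansion[of v] by (simp add: scalar_mult_eq_scaleR)
  then show ?thesis
    using assms by (simp add: linear_sum linear_scale)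
qed

lemma smooth_on_linear_D: "smooth_on f S \<Longrightarrow> x \<in> S \<Longrightarrow> linear (D f x)"
  using smooth_on_has_derivative has_derivative_bounded_linear bounded_linear.linear by blast

lemma form_axis_expansion:
  "form A u v = (\<Sum>i\<in>UNIV. \<Sum>j\<in>UNIV. u $ i * v $ j * A $ i $ j)"
  by (simp add: inner_vec_def matrix_vector_mult_def sum_distrib_left mult_ac)

lemma form_bilinear_expansion:
  fixes B :: "real ^ 'd \<Rightarrow> real ^ 'd \<Rightarrow> real"
  assumes "bilinear B" "\<And>i j. A $ i $ j = B (axis i 1) (axis j 1)"
  shows "form A u v = B u v"
proof -
  have "B u v = (\<Sum>i\<in>UNIV. u $ i * B (axis i 1) v)"
    using linear_axis_expansion[of "\<lambda>u. B u v" u] assms(1) by (simp add: bilinear_def)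
  also have "\<dots> = (\<Sum>i\<in>UNIV. u $ i * (\<Sum>j\<in>UNIV. v $ j * B (axis i 1) (axis j 1)))"
    using linear_axis_expansion[of "B _" v] assms(1) by (simp add: bilinear_def)
  finally show ?thesis
    by (simp add: form_axis_expansion assms(2) sum_distrib_left mult_ac)
qed

lemma bilinear_form_linear:
  "linear f \<Longrightarrow> bilinear (\<lambda>u v. form A (f u) (f v))"
  by (auto simp: bilinear_def intro!: linearI
      simp: linear_add linear_scale inner_add_left algebra_simps inner_add_right)

lemma form_pullback:
  "linear (D \<phi> y) \<Longrightarrow> form (pullback \<phi> A y) u v = form (A (\<phi> y)) (D \<phi> y u) (D \<phi> y v)"
  by (rule form_bilinear_expansion[OF bilinear_form_linear]) (simp_all add: pullback_def)

lemma smooth_on_form: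
  assumes "open S" "smooth_on A S" "smooth_on u S" "smooth_on v S"
  shows "smooth_on (\<lambda>x. form (A x) (u x) (v x)) S"
  using assms unfolding smooth_on_def
  by (metis Ck_on_bilinear[OF bounded_bilinear_inner]
      Ck_on_bilinear[OF bounded_bilinear_matrix_vector_mult])

lemma smooth_on_vecI:
  fixes f :: "'a::real_normed_vector \<Rightarrow> 'b::euclidean_space ^ 'n"
  shows "open S \<Longrightarrow> (\<And>i. smooth_on (\<lambda>x. f x $ i) S) \<Longrightarrow> smooth_on f S"
  by (simp add: smooth_on_def Ck_on_vecI)

lemma smooth_on_pullback:
  assumes "open S" "smooth_on \<phi> S" "smooth_on A T" "\<phi> ` S \<subseteq> T"
  shows "smooth_on (pullback \<phi> A) S"
proof (intro smooth_on_vecI assms(1))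
  fix i j
  have "smooth_on (\<lambda>y. form (A (\<phi> y)) (D \<phi> y (axis i 1)) (D \<phi> y (axis j 1))) S"
    by (rule smooth_on_form[OF assms(1) smooth_on_compose[OF assms(1,3,2,4)]
          smooth_on_frechet_derivative[OF assms(2)] smooth_on_frechet_derivative[OF assms(2)]])
  then show "smooth_on (\<lambda>y. pullback \<phi> A y $ i $ j) S"
    by (simp add: pullback_def)
qed

text \<open>On the right stand the velocity and the acceleration of the image curve. Differentiating
  the pulled-back matrix produces second derivatives of \<open>\<phi>\<close>; by their symmetry
  those that involve \<open>w\<close> cancel, and the one with \<open>u\<close> twice becomes part
  of the acceleration. Nothing requires \<open>D \<phi> x\<close> to be injective.\<close>

lemma euler_lagrange_pullback:
  assumes S: "open S" "x \<in> S" and \<phi>: "smooth_on \<phi> S" and A: "smooth_on A T" and T: "\<phi> ` S \<subseteq> T"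
    and sym: "\<And>y. y \<in> T \<Longrightarrow> transpose (A y) = A y"
  shows "euler_lagrange (pullback \<phi> A) x u a w
    = euler_lagrange A (\<phi> x) (D \<phi> x u) (D \<phi> x a + D (\<lambda>y. D \<phi> y u) x u) (D \<phi> x w)"
proof -
  let ?D2 = "\<lambda>v w. D (\<lambda>y. D \<phi> y v) x w"
  have lin: "linear (D \<phi> y)" if "y \<in> S" for y
    using smooth_on_linear_D[OF \<phi> that] .
  have "pullback \<phi> A differentiable (at x)"
    using smooth_on_differentiable[OF smooth_on_pullback[OF S(1) \<phi> A T] S(2)] .
  note P = this[unfolded frechet_derivative_works]
  have "(A has_derivative D A (\<phi> x)) (at (\<phi> x))"
    using smooth_on_has_derivative[OF A] T S(2) by blast
  from has_derivative_compose[OF smooth_on_has_derivative[OF \<phi> S(2)] this]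
  have A\<phi>: "((\<lambda>y. A (\<phi> y)) has_derivative (\<lambda>h. D A (\<phi> x) (D \<phi> x h))) (at x)" .
  have D2: "((\<lambda>y. D \<phi> y v) has_derivative ?D2 v) (at x)" for v
    using smooth_on_has_derivative[OF smooth_on_frechet_derivative[OF \<phi>] S(2)] .
  have DP: "form (D (pullback \<phi> A) x h) v w
      = form (A (\<phi> x)) (?D2 v h) (D \<phi> x w) + form (D A (\<phi> x) (D \<phi> x h)) (D \<phi> x v) (D \<phi> x w)
        + form (A (\<phi> x)) (D \<phi> x v) (?D2 w h)" for v w h
  proof -
    have "((\<lambda>y. form (pullback \<phi> A y) v w) has_derivative (\<lambda>h. form (D (pullback \<phi> A) x h) v w)) (at x)"
      using has_derivative_form[OF P has_derivative_const has_derivative_const] by simp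
    moreover have "((\<lambda>y. form (pullback \<phi> A y) v w) has_derivative
        (\<lambda>h. form (A (\<phi> x)) (?D2 v h) (D \<phi> x w) + form (D A (\<phi> x) (D \<phi> x h)) (D \<phi> x v) (D \<phi> x w)
        + form (A (\<phi> x)) (D \<phi> x v) (?D2 w h))) (at x)"
      using has_derivative_form[OF A\<phi> D2 D2] S
      by (rule has_derivative_transform_within_open) (simp add: form_pullback lin)
    ultimately show ?thesis
      by (rule has_derivative_unique[THEN fun_cong[where x = h]])
  qed
  have D2_sym: "?D2 v w = ?D2 w v" for v w
    using second_derivative_symmetric[OF S(1) \<phi> S(2)] .
  have A_sym: "form (A (\<phi> x)) v w = form (A (\<phi> x)) w v" for v w
    using form_commute sym T S(2) by blast
  show ?thesis
    unfolding euler_lagrange_def form_pullback[OF lin[OF S(2)]] DP D2_sym[of u w]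
      A_sym[of _ "D \<phi> x w"] A_sym[of "D (\<lambda>y. D \<phi> y w) x u"]
    by (simp add: algebra_simps inner_add_right)
qed

text \<open>Only the maps \<open>D \<phi> y v\<close> for fixed \<open>v\<close> are known to be
  differentiable, so \<open>u\<close> is expanded along the axes. Symmetry of the second derivative
  moves the axis vector into the linear slot, where the sum is reassembled.\<close>

lemma has_vector_derivative_D:
  fixes \<phi> :: "real ^ 'd \<Rightarrow> 'b::euclidean_space"
  assumes S: "open S" "x t \<in> S" and \<phi>: "smooth_on \<phi> S"
    and x: "(x has_vector_derivative x') (at t)" and u: "(u has_vector_derivative u') (at t)"
  shows "((\<lambda>s. D \<phi> (x s) (u s)) has_vector_derivative D \<phi> (x t) u' + D (\<lambda>y. D \<phi> y (u t)) (x t) x') (at t)"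
proof -
  let ?D2 = "\<lambda>v w. D (\<lambda>y. D \<phi> y v) (x t) w"
  have comp: "((\<lambda>s. g (x s)) has_vector_derivative D g (x t) x') (at t)" if g: "smooth_on g S"
    for g :: "real ^ 'd \<Rightarrow> 'b"
    using has_derivative_compose[OF x[unfolded has_vector_derivative_def] smooth_on_has_derivative[OF g S(2)]]
      smooth_on_linear_D[OF g S(2)] by (simp add: has_vector_derivative_def linear_scale)
  have sym: "?D2 v w = ?D2 w v" for v w
    using second_derivative_symmetric[OF S(1) \<phi> S(2)] .
  have "isCont x t"
    using x has_vector_derivative_continuous by blast
  then have "\<forall>\<^sub>F s in nhds t. x s \<in> S"
    using S unfolding continuous_at_open eventually_nhds by blast
  then obtain J where J: "open J" "t \<in> J" "\<And>s. s \<in> J \<Longrightarrow> x s \<in> S"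
    by (auto simp: eventually_nhds)
  have u_nth: "((\<lambda>s. u s $ i) has_vector_derivative u' $ i) (at t)" for i
    using bounded_linear.has_vector_derivative[OF bounded_linear_vec_nth u] .
  have "((\<lambda>s. \<Sum>i\<in>UNIV. u s $ i *\<^sub>R D \<phi> (x s) (axis i 1)) has_vector_derivative
      (\<Sum>i\<in>UNIV. u t $ i *\<^sub>R ?D2 (axis i 1) x' + u' $ i *\<^sub>R D \<phi> (x t) (axis i 1))) (at t)"
    using u_nth
    by (intro has_vector_derivative_sum has_vector_derivative_scaleR
        comp smooth_on_frechet_derivative[OF \<phi>]) (simp add: has_real_derivative_iff_has_vector_derivative)
  also have "(\<Sum>i\<in>UNIV. u t $ i *\<^sub>R ?D2 (axis i 1) x' + u' $ i *\<^sub>R D \<phi> (x t) (axis i 1))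
      = (\<Sum>i\<in>UNIV. u t $ i *\<^sub>R ?D2 x' (axis i 1)) + D \<phi> (x t) u'"
    using linear_axis_expansion[OF smooth_on_linear_D[OF \<phi> S(2)], of u']
    by (simp add: sum.distrib sym[of _ x'])
  also have "\<dots> = D \<phi> (x t) u' + ?D2 (u t) x'"
    using linear_axis_expansion[OF smooth_on_linear_D[OF smooth_on_frechet_derivative[OF \<phi>] S(2)], of x' "u t"]
    by (simp add: sym[of _ x'])
  finally have "((\<lambda>s. \<Sum>i\<in>UNIV. u s $ i *\<^sub>R D \<phi> (x s) (axis i 1)) has_vector_derivative
      D \<phi> (x t) u' + ?D2 (u t) x') (at t)" .
  then show ?thesis
    by (rule has_vector_derivative_transform_within_open[OF _ J(1,2)])
      (simp add: linear_axis_expansion[OF smooth_on_linear_D[OF \<phi> J(3)], symmetric])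
qed

section \<open>Positive definite matrices\<close>

definition posdef :: "real ^ 'd ^ 'd \<Rightarrow> bool" where
  "posdef A \<longleftrightarrow> transpose A = A \<and> (\<forall>u. u \<noteq> 0 \<longrightarrow> form A u u > 0)"

lemma posdef_form_commute: "posdef A \<Longrightarrow> form A u v = form A v u"
  by (simp add: posdef_def form_commute)

lemma posdef_form_nonneg: "posdef A \<Longrightarrow> form A u u \<ge> 0"
  by (cases "u = 0") (auto simp: posdef_def less_imp_le)

lemma posdef_form_eq_0: "posdef A \<Longrightarrow> form A u u = 0 \<longleftrightarrow> u = 0"
  unfolding posdef_def by (metis inner_zero_left less_irrefl)

lemma posdef_invertible: "posdef A \<Longrightarrow> invertible A"
  unfolding invertible_left_inverse matrix_left_invertible_ker
  by (metis inner_zero_right posdef_form_eq_0)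

lemma posdef_Cauchy_Schwarz:
  assumes "posdef A"
  shows "\<bar>form A u v\<bar> \<le> sqrt (form A u u) * sqrt (form A v v)"
proof (cases "v = 0")
  case False
  define s where "s = form A u v / form A v v"
  have pos: "form A v v > 0"
    using assms False by (auto simp: posdef_def)
  have "0 \<le> form A (u - s *\<^sub>R v) (u - s *\<^sub>R v)"
    using posdef_form_nonneg[OF assms] .
  also have "\<dots> = form A u u - 2 * s * form A u v + s\<^sup>2 * form A v v"
    using posdef_form_commute[OF assms, of v u]
    by (simp add: algebra_simps inner_diff_left power2_eq_square)
  also have "\<dots> = form A u u - (form A u v)\<^sup>2 / form A v v"
    using pos by (simp add: s_def power2_eq_square field_simps)
  finally have "(form A u v)\<^sup>2 \<le> form A u u * form A v v"
    using pos by (simp add: field_simps)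
  then have "sqrt ((form A u v)\<^sup>2) \<le> sqrt (form A u u * form A v v)"
    by (rule real_sqrt_le_mono)
  then show ?thesis
    by (simp add: real_sqrt_mult)
qed simp

text \<open>Let \<open>P\<close> be the Euclidean projection onto \<open>K\<close>. The map
  \<open>v \<mapsto> P (A *v v)\<close> is injective on \<open>K\<close>, because a zero forces
  \<open>form A v v = 0\<close>; by dimension it is onto \<open>K\<close>. A solution of
  \<open>P (A *v v) = P (A *v u)\<close> in \<open>K\<close> is the \<open>A\<close>-orthogonal
  projection of \<open>u\<close>.\<close>

lemma posdef_orthogonal_decomposition:
  assumes "posdef A" "subspace K"
  obtains v where "v \<in> K" "\<And>w. w \<in> K \<Longrightarrow> form A w (u - v) = 0"
proof -
  have decomp: "\<exists>y\<in>K. \<forall>w\<in>K. w \<bullet> (x - y) = 0" for x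
  proof -
    obtain y z where "y \<in> span K" "\<And>w. w \<in> span K \<Longrightarrow> orthogonal z w" "x = y + z"
      using orthogonal_subspace_decomp_exists[of K x] by metis
    then show ?thesis
      using span_eq_iff[THEN iffD2, OF assms(2)]
      by (intro bexI[of _ y]) (auto simp: orthogonal_def inner_commute)
  qed
  then obtain P where P: "\<And>x. P x \<in> K" "\<And>x w. w \<in> K \<Longrightarrow> w \<bullet> (x - P x) = 0"
    by metis
  have P_eqI: "P x = y" if "y \<in> K" "\<And>w. w \<in> K \<Longrightarrow> w \<bullet> (x - y) = 0" for x y
  proof -
    have "P x - y \<in> K"
      using P(1) that(1) assms(2) by (simp add: subspace_diff)
    from that(2)[OF this] P(2)[OF this, of x] have "(P x - y) \<bullet> (P x - y) = 0"
      by (simp add: inner_diff_right)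
    then show ?thesis
      by simp
  qed
  have "linear P"
  proof
    show "P (x + y) = P x + P y" for x y
      using P(1) P(2)[of _ x] P(2)[of _ y] assms(2)
      by (intro P_eqI) (auto simp: subspace_add inner_add_right inner_diff_right)
    show "P (r *\<^sub>R x) = r *\<^sub>R P x" for r x
      using P(1) P(2)[of _ x] assms(2)
      by (intro P_eqI) (auto simp: subspace_scale inner_diff_right)
  qed
  define T where "T v = P (A *v v)" for v
  have "linear T"
    unfolding T_def using linear_compose[OF matrix_vector_mul_linear \<open>linear P\<close>] by (simp add: o_def)
  have "inj_on T K"
  proof (subst linear_inj_on_iff_eq_0[OF \<open>linear T\<close> assms(2)], intro ballI impI)
    fix v assume v: "v \<in> K" "T v = 0"
    with P(2)[of v "A *v v"] have "form A v v = 0"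
      by (simp add: T_def)
    then show "v = 0"
      using posdef_form_eq_0[OF assms(1)] by blast
  qed
  then have "dim (T ` K) = dim K"
    using dim_image_eq[OF \<open>linear T\<close>] assms(2) by (metis span_eq_iff)
  moreover have "T ` K \<subseteq> K"
    using P(1) by (auto simp: T_def)
  ultimately have "T ` K = K"
    using subspace_dim_equal[OF linear_subspace_image[OF \<open>linear T\<close> assms(2)] assms(2)] by simp
  with P(1)[of "A *v u"] obtain v where v: "v \<in> K" "T v = P (A *v u)"
    by (metis imageE)
  have "form A w (u - v) = 0" if "w \<in> K" for w
    using P(2)[OF that, of "A *v u"] P(2)[OF that, of "A *v v"] v(2)
    by (simp add: T_def algebra_simps inner_diff_right)
  with v(1) show ?thesis
    by (rule that)
qed

lemma invertible_matrix_inv_right: "invertible A \<Longrightarrow> A ** matrix_inv A = mat 1"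
  unfolding invertible_def matrix_inv_def by (rule someI_ex[THEN conjunct1])

lemma smooth_on_det:
  assumes "open S" "\<And>i j. smooth_on (\<lambda>x. A x $ i $ j) S"
  shows "smooth_on (\<lambda>x. det (A x :: real ^ 'd ^ 'd)) S"
  using assms unfolding smooth_on_def det_def
  by (auto intro!: Ck_on_sum Ck_on_mult Ck_on_prod Ck_on_const)

text \<open>By Cramer's rule each entry of the inverse is a quotient of determinants, and these are
  polynomials in the entries.\<close>

lemma smooth_on_matrix_inv:
  fixes A :: "'a::real_normed_vector \<Rightarrow> real ^ 'd ^ 'd"
  assumes S: "open S" and A: "\<And>i j. smooth_on (\<lambda>x. A x $ i $ j) S"
    and inv: "\<And>x. x \<in> S \<Longrightarrow> invertible (A x)"
  shows "smooth_on (\<lambda>x. matrix_inv (A x) $ k $ l) S"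
proof -
  \<comment> \<open>\<open>A x\<close> with its column \<open>k\<close> replaced by the unit vector
    \<open>axis l 1\<close>, as Cramer's rule requires for column \<open>l\<close> of the
    inverse.\<close>
  define B where "B x = (\<chi> i j. if j = k then axis l 1 $ i else A x $ i $ j)" for x
  have "matrix_inv (A x) $ k $ l = inverse (det (A x)) * det (B x)" if "x \<in> S" for x
  proof -
    have "A x *v (matrix_inv (A x) *v axis l 1) = axis l 1"
      using invertible_matrix_inv_right[OF inv[OF that]] by (simp add: matrix_vector_mul_assoc)
    moreover have "det (A x) \<noteq> 0"
      using inv[OF that] by (simp add: invertible_det_nz)
    ultimately have "(matrix_inv (A x) *v axis l 1) $ k = det (B x) / det (A x)"
      by (subst (asm) cramer) (auto simp: B_def)
    then show ?thesis
      by (simp add: matrix_vector_mult_basis column_def field_simps)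
  qed
  moreover have "smooth_on (\<lambda>x. inverse (det (A x)) * det (B x)) S"
  proof (rule smooth_on_mult[OF S])
    show "smooth_on (\<lambda>x. inverse (det (A x))) S"
      using smooth_on_det[OF S A] inv
      unfolding smooth_on_def by (auto intro!: Ck_on_inverse S simp: invertible_det_nz)
    have "smooth_on (\<lambda>x. B x $ i $ j) S" for i j
      using A[of i j] by (cases "j = k") (simp_all add: B_def smooth_on_const)
    then show "smooth_on (\<lambda>x. det (B x)) S"
      by (rule smooth_on_det[OF S])
  qed
  ultimately show ?thesis
    using smooth_on_cong[OF S, of "\<lambda>x. inverse (det (A x)) * det (B x)"] by simp
qed

section \<open>The geodesic equation in a chart\<close>

text \<open>Multiplication by \<open>G x\<close> cancels the inverse matrix in the Christoffel
  symbols. After contraction with \<open>u\<close> twice, the first two of the three derivative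
  terms coincide, and their two halves add up to the first summand on the right.\<close>

lemma form_christoffel:
  fixes A :: "('a, 'd::finite) chart set" and g c
  defines "G \<equiv> metric_matrix A g c"
  assumes G: "G differentiable (at x)" and inv: "invertible (G x)"
  shows "form (G x) w (\<chi> k. \<Sum>i\<in>UNIV. \<Sum>j\<in>UNIV. christoffel A g c x k i j * u $ i * u $ j)
    = form (D G x u) u w - form (D G x w) u u / 2"
proof -
  define d where "d i j l = D G x (axis i 1) $ j $ l" for i j l
  note DG = G[unfolded frechet_derivative_works]
  have lin: "linear (D G x)"
    using has_derivative_bounded_linear[OF DG] bounded_linear.linear by blast
  have DG_nth: "D G x v $ j $ l = (\<Sum>i\<in>UNIV. v $ i * d i j l)" for v j l
    by (subst linear_axis_expansion[OF lin]) (simp add: d_def)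
  have partial: "partial_deriv i (\<lambda>y. G y $ j $ l) x = d i j l" for i j l
  proof -
    have "((\<lambda>y. G y $ j $ l) has_derivative (\<lambda>h. D G x h $ j $ l)) (at x)"
      using bounded_linear.has_derivative[OF bounded_linear_vec_nth
          bounded_linear.has_derivative[OF bounded_linear_vec_nth DG]] .
    from frechet_derivative_at[OF this] show ?thesis
      by (metis partial_deriv_def d_def)
  qed
  \<comment> \<open>The Christoffel symbols of the first kind, contracted with \<open>u\<close>
    twice.\<close>
  define q where "q = (\<chi> l. \<Sum>i\<in>UNIV. \<Sum>j\<in>UNIV. (d i j l + d j i l - d l i j) * u $ i * u $ j / 2)"
  have "(\<Sum>i\<in>UNIV. \<Sum>j\<in>UNIV. christoffel A g c x k i j * u $ i * u $ j) = (matrix_inv (G x) *v q) $ k" for k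
  proof -
    have "(\<Sum>i\<in>UNIV. \<Sum>j\<in>UNIV. christoffel A g c x k i j * u $ i * u $ j)
        = (\<Sum>i\<in>UNIV. \<Sum>j\<in>UNIV. \<Sum>l\<in>UNIV. matrix_inv (G x) $ k $ l * ((d i j l + d j i l - d l i j) * u $ i * u $ j / 2))"
      unfolding christoffel_def G_def[symmetric] partial
      by (simp add: sum_distrib_left sum_distrib_right sum_divide_distrib mult_ac)
    also have "\<dots> = (\<Sum>i\<in>UNIV. \<Sum>l\<in>UNIV. \<Sum>j\<in>UNIV. matrix_inv (G x) $ k $ l * ((d i j l + d j i l - d l i j) * u $ i * u $ j / 2))"
      by (intro sum.cong refl sum.swap)
    also have "\<dots> = (\<Sum>l\<in>UNIV. \<Sum>i\<in>UNIV. \<Sum>j\<in>UNIV. matrix_inv (G x) $ k $ l * ((d i j l + d j i l - d l i j) * u $ i * u $ j / 2))"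
      by (rule sum.swap)
    also have "\<dots> = (matrix_inv (G x) *v q) $ k"
      by (simp add: matrix_vector_mult_def q_def sum_distrib_left)
    finally show ?thesis .
  qed
  then have "(\<chi> k. \<Sum>i\<in>UNIV. \<Sum>j\<in>UNIV. christoffel A g c x k i j * u $ i * u $ j) = matrix_inv (G x) *v q"
    by (simp add: vec_eq_iff)
  then have "form (G x) w (\<chi> k. \<Sum>i\<in>UNIV. \<Sum>j\<in>UNIV. christoffel A g c x k i j * u $ i * u $ j) = w \<bullet> q"
    using invertible_matrix_inv_right[OF inv] by (simp add: matrix_vector_mul_assoc)
  also have "w \<bullet> q = (\<Sum>l\<in>UNIV. \<Sum>i\<in>UNIV. \<Sum>j\<in>UNIV. w $ l * u $ i * u $ j * d i j l / 2)
      + (\<Sum>l\<in>UNIV. \<Sum>i\<in>UNIV. \<Sum>j\<in>UNIV. w $ l * u $ i * u $ j * d j i l / 2)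
      - (\<Sum>l\<in>UNIV. \<Sum>i\<in>UNIV. \<Sum>j\<in>UNIV. w $ l * u $ i * u $ j * d l i j / 2)"
    by (simp add: inner_vec_def q_def sum_distrib_left sum.distrib[symmetric] sum_subtractf[symmetric]
        algebra_simps add_divide_distrib diff_divide_distrib)
  also have "(\<Sum>l\<in>UNIV. \<Sum>i\<in>UNIV. \<Sum>j\<in>UNIV. w $ l * u $ i * u $ j * d j i l / 2)
      = (\<Sum>l\<in>UNIV. \<Sum>i\<in>UNIV. \<Sum>j\<in>UNIV. w $ l * u $ i * u $ j * d i j l / 2)"
    by (rule sum.cong[OF refl], subst sum.swap) (simp add: mult_ac)
  also have "(\<Sum>l\<in>UNIV. \<Sum>i\<in>UNIV. \<Sum>j\<in>UNIV. w $ l * u $ i * u $ j * d i j l / 2)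
      = form (D G x u) u w / 2"
    unfolding form_axis_expansion DG_nth
    by (subst sum.cong[OF refl sum.swap], subst sum.swap)
      (simp add: sum_distrib_left sum_distrib_right sum_divide_distrib mult_ac)
  also have "(\<Sum>l\<in>UNIV. \<Sum>i\<in>UNIV. \<Sum>j\<in>UNIV. w $ l * u $ i * u $ j * d l i j / 2)
      = form (D G x w) u u / 2"
    unfolding form_axis_expansion DG_nth
    by (subst sum.swap, subst sum.cong[OF refl sum.swap])
      (simp add: sum_distrib_left sum_distrib_right sum_divide_distrib mult_ac)
  finally show ?thesis
    by simp
qed

lemma geodesic_equation_iff_euler_lagrange:
  fixes A :: "('a, 'd::finite) chart set"
  assumes "metric_matrix A g c differentiable (at x)" and pos: "posdef (metric_matrix A g c x)"
  shows "(\<forall>k. a $ k + (\<Sum>i\<in>UNIV. \<Sum>j\<in>UNIV. christoffel A g c x k i j * u $ i * u $ j) = 0)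
    \<longleftrightarrow> (\<forall>w. euler_lagrange (metric_matrix A g c) x u a w = 0)"
proof -
  define b where "b = a + (\<chi> k. \<Sum>i\<in>UNIV. \<Sum>j\<in>UNIV. christoffel A g c x k i j * u $ i * u $ j)"
  have "euler_lagrange (metric_matrix A g c) x u a w = form (metric_matrix A g c x) w b" for w
    using form_christoffel[OF assms(1) posdef_invertible[OF pos], of w u]
    by (simp add: euler_lagrange_def b_def algebra_simps inner_add_right)
  \<comment> \<open>Definiteness enters here: the test vector \<open>w = b\<close> already forces
    \<open>b = 0\<close>.\<close>
  moreover have "(\<forall>w. form (metric_matrix A g c x) w b = 0) \<longleftrightarrow> b = 0"
    using posdef_form_eq_0[OF pos] by (metis matrix_vector_mult_0_right inner_zero_right)
  ultimately show ?thesis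
    by (simp add: b_def vec_eq_iff)
qed

section \<open>Charts and tangent vectors\<close>

lemma
  assumes "smooth_atlas A" "c \<in> A"
  shows open_cdom: "open (cdom c)"
    and open_cmap_cdom: "open (cmap c ` cdom c)"
    and chart_homeomorphism: "homeomorphism (cdom c) (cmap c ` cdom c) (cmap c) (cinv c)"
  using assms by (auto simp: smooth_atlas_def)

lemma cinv_cmap: "smooth_atlas A \<Longrightarrow> c \<in> A \<Longrightarrow> p \<in> cdom c \<Longrightarrow> cinv c (cmap c p) = p"
  using homeomorphism_apply1[OF chart_homeomorphism] .

lemma open_cmap_image:
  assumes "smooth_atlas A" "c \<in> A" "open U"
  shows "open (cmap c ` (cdom c \<inter> U))"
proof -
  have "openin (top_of_set (cdom c)) (cdom c \<inter> U)"
    using assms(3) by (simp add: openin_open_Int)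
  from homeomorphism_imp_open_map[OF chart_homeomorphism[OF assms(1,2)] this] show ?thesis
    using open_cmap_cdom[OF assms(1,2)] openin_open_trans by blast
qed

lemma charts_at_nonempty: "smooth_atlas A \<Longrightarrow> \<exists>c. c \<in> charts_at A p"
  unfolding smooth_atlas_def charts_at_def by blast

lemma smooth_on_transition:
  "smooth_atlas A \<Longrightarrow> c \<in> A \<Longrightarrow> d \<in> A \<Longrightarrow> smooth_on (cmap d \<circ> cinv c) (cmap c ` (cdom c \<inter> cdom d))"
  by (simp add: smooth_atlas_def)

lemma transition_differentiable:
  assumes "smooth_atlas A" "c \<in> charts_at A p" "d \<in> charts_at A p"
  shows "(cmap d \<circ> cinv c) differentiable (at (cmap c p))"
  using assms smooth_on_differentiable[OF smooth_on_transition[OF assms(1), of c d]]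
  by (simp add: charts_at_def)

lemma D_chart_change:
  assumes A: "smooth_atlas A" and c: "c \<in> charts_at A p" and d: "d \<in> charts_at A p"
    and h: "(h \<circ> cinv d) differentiable (at (cmap d p))"
  shows "D (h \<circ> cinv c) (cmap c p) v = D (h \<circ> cinv d) (cmap d p) (D (cmap d \<circ> cinv c) (cmap c p) v)"
proof -
  have cA: "c \<in> A" "p \<in> cdom c" and dA: "d \<in> A" "p \<in> cdom d"
    using c d by (auto simp: charts_at_def)
  have eq: "(cmap d \<circ> cinv c) (cmap c p) = cmap d p"
    using cinv_cmap[OF A cA] by simp
  have "((h \<circ> cinv d) \<circ> (cmap d \<circ> cinv c) has_derivative
      D (h \<circ> cinv d) (cmap d p) \<circ> D (cmap d \<circ> cinv c) (cmap c p)) (at (cmap c p))"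
    using transition_differentiable[OF A c d] h unfolding frechet_derivative_works
    by (intro diff_chain_at) (simp_all only: eq)
  then have "(h \<circ> cinv c has_derivative
      D (h \<circ> cinv d) (cmap d p) \<circ> D (cmap d \<circ> cinv c) (cmap c p)) (at (cmap c p))"
  proof (rule has_derivative_transform_within_open)
    show "open (cmap c ` (cdom c \<inter> cdom d))" "cmap c p \<in> cmap c ` (cdom c \<inter> cdom d)"
      using open_cmap_image[OF A cA(1) open_cdom[OF A dA(1)]] cA dA by auto
    show "((h \<circ> cinv d) \<circ> (cmap d \<circ> cinv c)) x = (h \<circ> cinv c) x" if "x \<in> cmap c ` (cdom c \<inter> cdom d)" for x
      using that cinv_cmap[OF A cA(1)] cinv_cmap[OF A dA(1)] by auto
  qed
  from frechet_derivative_at[OF this] show ?thesis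
    by (metis comp_apply)
qed

lemma D_chart_self:
  assumes A: "smooth_atlas A" and c: "c \<in> charts_at A p"
  shows "D (cmap c \<circ> cinv c) (cmap c p) v = v"
proof -
  have cA: "c \<in> A" "p \<in> cdom c"
    using c by (auto simp: charts_at_def)
  have "((\<lambda>x. x) has_derivative (\<lambda>v. v)) (at (cmap c p))"
    by simp
  then have "(cmap c \<circ> cinv c has_derivative (\<lambda>v. v)) (at (cmap c p))"
    using open_cmap_cdom[OF A cA(1)]
    by (rule has_derivative_transform_within_open) (use cA cinv_cmap[OF A cA(1)] in auto)
  from frechet_derivative_at[OF this] show ?thesis
    by metis
qed

text \<open>Inverse of the coordinate map \<open>v \<mapsto> v c\<close> on the tangent space at
  \<open>p\<close>. Through it every pointwise statement about tangent vectors becomes one about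
  vectors and matrices in a single chart.\<close>

definition tlift :: "('a, 'd::finite) chart set \<Rightarrow> ('a, 'd) chart \<Rightarrow> 'a \<Rightarrow> real ^ 'd \<Rightarrow> ('a, 'd) tvec" where
  "tlift A c p u = (\<lambda>d. if d \<in> charts_at A p then D (cmap d \<circ> cinv c) (cmap c p) u else 0)"

lemma coord_vec_eq_tlift: "coord_vec A c p i = tlift A c p (axis i 1)"
  by (simp add: coord_vec_def tlift_def)

lemma tlift_chart_change:
  assumes "smooth_atlas A" "c \<in> charts_at A p" "d \<in> charts_at A p"
  shows "tlift A c p u = tlift A d p (D (cmap d \<circ> cinv c) (cmap c p) u)"
  using D_chart_change[OF assms transition_differentiable[OF assms(1,3)]]
  by (auto simp: tlift_def fun_eq_iff)

lemma tlift_self: "smooth_atlas A \<Longrightarrow> c \<in> charts_at A p \<Longrightarrow> tlift A c p u c = u"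
  by (simp add: tlift_def D_chart_self)

lemma tlift_in_tangent_space:
  assumes "smooth_atlas A" "c \<in> charts_at A p"
  shows "tlift A c p u \<in> tangent_space A p"
  unfolding tangent_space_def mem_Collect_eq
proof (intro conjI ballI allI impI)
  fix a b
  assume a: "a \<in> charts_at A p" and b: "b \<in> charts_at A p"
  show "tlift A c p u b = D (cmap b \<circ> cinv a) (cmap a p) (tlift A c p u a)"
    using D_chart_change[OF assms a transition_differentiable[OF assms(1) a b], of u] a b
    by (simp only: tlift_def if_True)
qed (simp add: tlift_def)

lemma tlift_coordinates:
  assumes "c \<in> charts_at A p" "v \<in> tangent_space A p"
  shows "tlift A c p (v c) = v"
proof
  fix d
  show "tlift A c p (v c) d = v d"
  proof (cases "d \<in> charts_at A p")
    case True
    then have "v d = D (cmap d \<circ> cinv c) (cmap c p) (v c)"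
      using assms unfolding tangent_space_def by blast
    with True show ?thesis
      unfolding tlift_def by (simp only: if_True)
  next
    case False
    moreover from False have "v d = 0"
      using assms(2) unfolding tangent_space_def by blast
    ultimately show ?thesis
      by (simp add: tlift_def)
  qed
qed

lemma tangent_space_eq_image:
  "smooth_atlas A \<Longrightarrow> c \<in> charts_at A p \<Longrightarrow> tangent_space A p = range (tlift A c p)"
  using tlift_in_tangent_space[of A c p] tlift_coordinates[of c A p] by (metis image_subsetI rangeI subsetI subset_antisym)

lemma
  assumes "smooth_atlas A" "c \<in> charts_at A p"
  shows tlift_add: "tlift A c p (u + v) = tadd (tlift A c p u) (tlift A c p v)"
    and tlift_scaleR: "tlift A c p (r *\<^sub>R u) = tscale r (tlift A c p u)"
proof -
  have "linear (D (cmap d \<circ> cinv c) (cmap c p))" if "d \<in> charts_at A p" for d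
    using transition_differentiable[OF assms that] unfolding frechet_derivative_works
    using has_derivative_bounded_linear bounded_linear.linear by blast
  then show "tlift A c p (u + v) = tadd (tlift A c p u) (tlift A c p v)"
    "tlift A c p (r *\<^sub>R u) = tscale r (tlift A c p u)"
    by (auto simp: tlift_def tadd_def tscale_def linear_add linear_scale)
qed

lemma tlift_eq_tzero_iff:
  assumes "smooth_atlas A" "c \<in> charts_at A p"
  shows "tlift A c p u = tzero \<longleftrightarrow> u = 0"
proof
  show "u = 0" if "tlift A c p u = tzero"
    using tlift_self[OF assms, of u] that by (simp add: tzero_def)
  show "tlift A c p u = tzero" if "u = 0"
    using tlift_scaleR[OF assms, of 0 0] that by (simp add: tscale_def tzero_def)
qed

section \<open>Metrics and geodesics in charts\<close>

locale metric_in_charts =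
  fixes A :: "('a::{t2_space,second_countable_topology}, 'd::finite) chart set" and g :: "('a, 'd) metric"
  assumes riemannian: "riemannian_manifold A g"
begin

lemma atlas: "smooth_atlas A"
  and metric: "riemannian_metric A g"
  using riemannian by (simp_all add: riemannian_manifold_def)

abbreviation "G \<equiv> metric_matrix A g"

lemma g_commute: "u \<in> tangent_space A p \<Longrightarrow> v \<in> tangent_space A p \<Longrightarrow> g p u v = g p v u"
  using metric by (simp add: riemannian_metric_def)

lemma g_pos: "u \<in> tangent_space A p \<Longrightarrow> u \<noteq> tzero \<Longrightarrow> g p u u > 0"
  using metric unfolding riemannian_metric_def by blast

lemma g_tlift:
  assumes c: "c \<in> charts_at A p"
  shows "g p (tlift A c p u) (tlift A c p v) = form (G c (cmap c p)) u v"
proof (rule form_bilinear_expansion[symmetric])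
  have lin: "linear (\<lambda>u. g p (tlift A c p u) (tlift A c p v))" for v
    using metric tlift_in_tangent_space[OF atlas c]
    by (intro linearI) (simp_all add: riemannian_metric_def tlift_add[OF atlas c] tlift_scaleR[OF atlas c])
  then show "bilinear (\<lambda>u v. g p (tlift A c p u) (tlift A c p v))"
    unfolding bilinear_def using g_commute[OF tlift_in_tangent_space[OF atlas c] tlift_in_tangent_space[OF atlas c]]
    by simp
  show "G c (cmap c p) $ i $ j = g p (tlift A c p (axis i 1)) (tlift A c p (axis j 1))" for i j
    using c cinv_cmap[OF atlas, of c p]
    by (simp add: charts_at_def metric_matrix_def coord_vec_eq_tlift)
qed

lemma posdef_G:
  assumes c: "c \<in> charts_at A p"
  shows "posdef (G c (cmap c p))"
  unfolding posdef_def
proof (intro conjI allI impI)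
  have "G c (cmap c p) $ i $ j = G c (cmap c p) $ j $ i" for i j
    using g_tlift[OF c, of "axis i 1" "axis j 1"] g_tlift[OF c, of "axis j 1" "axis i 1"]
      g_commute[OF tlift_in_tangent_space[OF atlas c] tlift_in_tangent_space[OF atlas c]]
    by (simp add: inner_axis_axis inner_axis' matrix_vector_mul_component inner_axis)
  then show "transpose (G c (cmap c p)) = G c (cmap c p)"
    by (simp add: transpose_def vec_eq_iff)
  show "form (G c (cmap c p)) u u > 0" if "u \<noteq> 0" for u
    using g_pos[OF tlift_in_tangent_space[OF atlas c]] tlift_eq_tzero_iff[OF atlas c] that
    unfolding g_tlift[OF c, symmetric] by blast
qed

lemma smooth_on_G_nth: "c \<in> A \<Longrightarrow> smooth_on (\<lambda>x. G c x $ i $ j) (cmap c ` cdom c)"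
  using metric by (simp add: riemannian_metric_def)

lemma smooth_on_G: "c \<in> A \<Longrightarrow> smooth_on (G c) (cmap c ` cdom c)"
  using open_cmap_cdom[OF atlas] smooth_on_G_nth by (intro smooth_on_vecI) auto

lemma G_differentiable: "c \<in> charts_at A p \<Longrightarrow> G c differentiable (at (cmap c p))"
  using smooth_on_differentiable[OF smooth_on_G] by (simp add: charts_at_def)

lemma G_chart_change:
  assumes "c \<in> A" "d \<in> A" "y \<in> cmap c ` (cdom c \<inter> cdom d)"
  shows "G c y = pullback (cmap d \<circ> cinv c) (G d) y"
proof -
  obtain p where y: "y = cmap c p" and p: "c \<in> charts_at A p" "d \<in> charts_at A p"
    using assms by (auto simp: charts_at_def)
  have "cinv c y = p"
    using cinv_cmap[OF atlas] p y by (auto simp: charts_at_def)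
  then show ?thesis
    by (simp add: vec_eq_iff metric_matrix_def[of A g c] coord_vec_eq_tlift pullback_def g_tlift[OF p(2)]
        tlift_chart_change[OF atlas p] y)
qed

lemma smooth_on_christoffel:
  assumes c: "c \<in> A"
  shows "smooth_on (\<lambda>x. christoffel A g c x k i j) (cmap c ` cdom c)"
proof -
  let ?S = "cmap c ` cdom c"
  have S: "open ?S"
    using open_cmap_cdom[OF atlas c] .
  have partial: "Ck_on n (\<lambda>x. partial_deriv i (\<lambda>y. G c y $ j $ l) x) ?S" for n i j l
    using smooth_on_frechet_derivative[OF smooth_on_G_nth[OF c]]
    by (simp add: smooth_on_def partial_deriv_def)
  have "invertible (G c x)" if "x \<in> ?S" for x
    using that c by (auto intro!: posdef_invertible posdef_G simp: charts_at_def)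
  then have "Ck_on n (\<lambda>x. matrix_inv (G c x) $ k $ l) ?S" for n k l
    using smooth_on_matrix_inv[OF S smooth_on_G_nth[OF c]] by (simp add: smooth_on_def)
  then show ?thesis
    unfolding smooth_on_def christoffel_def divide_inverse
    by (intro allI Ck_on_mult Ck_on_sum Ck_on_diff Ck_on_add partial S Ck_on_const) blast
qed

lemma
  assumes \<alpha>: "geodesic_on A g I \<alpha>" and t: "t \<in> I" and c: "c \<in> charts_at A (\<alpha> t)"
  defines "x \<equiv> cmap c \<circ> \<alpha>"
  defines "u \<equiv> \<lambda>s. vector_derivative x (at s)"
  shows geodesic_chart_domain: "open (I \<inter> \<alpha> -` cdom c)"
    and geodesic_position: "(x has_vector_derivative u t) (at t)"
    and geodesic_velocity: "(u has_vector_derivative vector_derivative u (at t)) (at t)"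
    and geodesic_euler_lagrange: "euler_lagrange (G c) (x t) (u t) (vector_derivative u (at t)) w = 0"
proof -
  let ?J = "I \<inter> \<alpha> -` cdom c"
  have cA: "c \<in> A" "\<alpha> t \<in> cdom c"
    using c by (auto simp: charts_at_def)
  show J: "open ?J"
    using \<alpha> open_cdom[OF atlas cA(1)] by (auto simp: geodesic_on_def continuous_on_open_vimage Int_commute)
  have x: "smooth_on x ?J"
    using \<alpha> cA by (simp add: geodesic_on_def x_def)
  have tJ: "t \<in> ?J"
    using t cA by simp
  show "(x has_vector_derivative u t) (at t)"
    using smooth_on_differentiable[OF x tJ] by (simp add: u_def vector_derivative_works)
  have "smooth_on u ?J"
  proof (rule smooth_on_cong[OF J])
    show "smooth_on (\<lambda>s. D x s 1) ?J"
      using smooth_on_frechet_derivative[OF x] .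
    show "D x s 1 = u s" if "s \<in> ?J" for s
      using frechet_derivative_eq_vector_derivative[OF smooth_on_differentiable[OF x that]]
      by (simp add: u_def)
  qed
  from smooth_on_differentiable[OF this tJ]
  show "(u has_vector_derivative vector_derivative u (at t)) (at t)"
    by (simp add: vector_derivative_works)
  have "vector_derivative u (at t) $ k + (\<Sum>i\<in>UNIV. \<Sum>j\<in>UNIV. christoffel A g c (x t) k i j * u t $ i * u t $ j) = 0" for k
    using \<alpha> cA t by (simp add: geodesic_on_def x_def u_def)
  then have "\<forall>w. euler_lagrange (G c) (x t) (u t) (vector_derivative u (at t)) w = 0"
    using geodesic_equation_iff_euler_lagrange[OF G_differentiable[OF c] posdef_G[OF c],
        of "vector_derivative u (at t)" "u t"]
    by (simp add: x_def)
  then show "euler_lagrange (G c) (x t) (u t) (vector_derivative u (at t)) w = 0" ..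
qed

text \<open>The equation is solved as a first-order system in the chart \<open>c\<close> and the
  solution is carried to the manifold by \<open>cinv c\<close>. The work lies in
  \<open>geodesic_on\<close>, which demands the equation in every chart that the curve meets;
  naturality of \<open>euler_lagrange\<close> under the transition maps supplies it.\<close>

lemma geodesic_exists:
  assumes c: "c \<in> charts_at A p"
  obtains e \<alpha> where "e > 0" "geodesic_on A g {-e<..<e} \<alpha>" "\<alpha> 0 = p"
    "vector_derivative (cmap c \<circ> \<alpha>) (at 0) = u"
proof -
  let ?S = "cmap c ` cdom c"
  have cA: "c \<in> A" "p \<in> cdom c"
    using c by (auto simp: charts_at_def)
  have S: "open ?S"
    using open_cmap_cdom[OF atlas cA(1)] .
  have S2: "open (?S \<times> (UNIV :: (real ^ 'd) set))"
    using S by (simp add: open_Times)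
  define acc where "acc z = (\<chi> k. - (\<Sum>i\<in>UNIV. \<Sum>j\<in>UNIV.
    christoffel A g c (fst z) k i j * snd z $ i * snd z $ j))" for z :: "(real ^ 'd) \<times> (real ^ 'd)"
  \<comment> \<open>The geodesic spray on pairs of position and velocity.\<close>
  define \<Phi> where "\<Phi> z = (snd z, acc z)" for z :: "(real ^ 'd) \<times> (real ^ 'd)"
  have smooth_acc: "Ck_on n acc (?S \<times> UNIV)" for n
  proof (rule Ck_on_vecI[OF S2])
    fix k
    have chr: "Ck_on n (\<lambda>z :: (real ^ 'd) \<times> (real ^ 'd). christoffel A g c (fst z) k i j) (?S \<times> UNIV)" for i j
      using smooth_on_christoffel[OF cA(1)] unfolding smooth_on_def
      by (intro Ck_on_compose[OF S2 _ Ck_on_bounded_linear[OF bounded_linear_fst S2]]) auto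
    have nth: "Ck_on n (\<lambda>z :: (real ^ 'd) \<times> (real ^ 'd). snd z $ i) (?S \<times> UNIV)" for i
      using bounded_linear_compose[OF bounded_linear_vec_nth bounded_linear_snd] S2
      by (rule Ck_on_bounded_linear)
    have "Ck_on n (\<lambda>z. (- 1) * (\<Sum>i\<in>UNIV. \<Sum>j\<in>UNIV.
        christoffel A g c (fst z) k i j * snd z $ i * snd z $ j)) (?S \<times> UNIV)"
      by (intro Ck_on_mult Ck_on_sum S2 Ck_on_const chr nth)
    then show "Ck_on n (\<lambda>z. acc z $ k) (?S \<times> UNIV)"
      by (simp add: acc_def)
  qed
  have smooth_\<Phi>: "smooth_on \<Phi> (?S \<times> UNIV)"
    unfolding smooth_on_def
  proof
    fix n
    have "bounded_linear (\<lambda>v :: real ^ 'd. (0 :: real ^ 'd, v))"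
      by (intro bounded_linear_Pair bounded_linear_zero bounded_linear_ident)
    from Ck_on_linear[OF this S2 smooth_acc]
    have "Ck_on n (\<lambda>z. (0 :: real ^ 'd, acc z)) (?S \<times> UNIV)" .
    moreover have "Ck_on n (\<lambda>z :: (real ^ 'd) \<times> (real ^ 'd). (snd z, 0 :: real ^ 'd)) (?S \<times> UNIV)"
      by (intro Ck_on_bounded_linear bounded_linear_Pair bounded_linear_zero bounded_linear_snd S2)
    ultimately have "Ck_on n (\<lambda>z. (snd z, 0) + (0, acc z)) (?S \<times> UNIV)"
      by (intro Ck_on_add[OF S2])
    then show "Ck_on n \<Phi> (?S \<times> UNIV)"
      by (simp add: \<Phi>_def[abs_def])
  qed
  have "(cmap c p, u) \<in> ?S \<times> UNIV" "Ck_on 1 \<Phi> (?S \<times> UNIV)"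
    using cA smooth_\<Phi> by (auto simp: smooth_on_def)
  from ode_solution[OF S2 this]
  obtain e z where e: "e > 0" and z0: "z 0 = (cmap c p, u)"
    and z: "\<And>t. t \<in> {-e<..<e} \<Longrightarrow> z t \<in> ?S \<times> UNIV \<and> (z has_vector_derivative \<Phi> (z t)) (at t)"
    by metis
  define x where "x t = fst (z t)" for t
  define v where "v t = snd (z t)" for t
  let ?J = "{-e<..<e}"
  have xS: "x t \<in> ?S" and x': "(x has_vector_derivative v t) (at t)"
    and v': "(v has_vector_derivative acc (x t, v t)) (at t)" if "t \<in> ?J" for t
    using z[OF that] bounded_linear.has_vector_derivative[OF bounded_linear_fst, of z]
      bounded_linear.has_vector_derivative[OF bounded_linear_snd, of z]
    by (auto simp: x_def[abs_def] v_def[abs_def] \<Phi>_def)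
  have smooth_x: "smooth_on x ?J"
    unfolding x_def using smooth_on_ode_solution[OF _ smooth_\<Phi> z, of ?J]
    by (intro smooth_on_linear[OF bounded_linear_fst]) auto
  define \<alpha> where "\<alpha> t = cinv c (x t)" for t
  have cont_x: "continuous_on ?J x"
    using smooth_x by (auto simp: smooth_on_def dest: spec[of _ 0])
  have \<alpha>_dom: "c \<in> charts_at A (\<alpha> t)" "cmap c (\<alpha> t) = x t" if "t \<in> ?J" for t
    using xS[OF that] cinv_cmap[OF atlas cA(1)] cA by (auto simp: \<alpha>_def charts_at_def)
  have cont_\<alpha>: "continuous_on ?J \<alpha>"
    unfolding \<alpha>_def using homeomorphism_cont2[OF chart_homeomorphism[OF atlas cA(1)]] cont_x xS
    by (intro continuous_on_compose2[of _ "cinv c" ?J x]) auto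
  have el: "euler_lagrange (G c) (x t) (v t) (acc (x t, v t)) w = 0" if "t \<in> ?J" for t w
    using geodesic_equation_iff_euler_lagrange[OF G_differentiable[OF \<alpha>_dom(1)[OF that]] posdef_G[OF \<alpha>_dom(1)[OF that]],
        of "acc (x t, v t)" "v t"] \<alpha>_dom(2)[OF that]
    by (simp add: acc_def)
  \<comment> \<open>The clause on the first derivative goes beyond \<open>geodesic_on\<close>; taken
    for \<open>d = c\<close> at time 0 it yields the prescribed initial velocity.\<close>
  have chart: "smooth_on (cmap d \<circ> \<alpha>) (?J \<inter> \<alpha> -` cdom d) \<and>
      (\<forall>t\<in>?J \<inter> \<alpha> -` cdom d. vector_derivative (cmap d \<circ> \<alpha>) (at t) = D (cmap d \<circ> cinv c) (x t) (v t) \<and> (\<forall>k.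
         vector_derivative (\<lambda>s. vector_derivative (cmap d \<circ> \<alpha>) (at s)) (at t) $ k
         + (\<Sum>i\<in>UNIV. \<Sum>j\<in>UNIV. christoffel A g d (cmap d (\<alpha> t)) k i j
              * vector_derivative (cmap d \<circ> \<alpha>) (at t) $ i
              * vector_derivative (cmap d \<circ> \<alpha>) (at t) $ j) = 0))" if dA: "d \<in> A" for d
  proof (intro conjI ballI)
    let ?\<phi> = "cmap d \<circ> cinv c" and ?T = "cmap c ` (cdom c \<inter> cdom d)" and ?K = "?J \<inter> \<alpha> -` cdom d"
    let ?y = "cmap d \<circ> \<alpha>"
    have y: "?y = (\<lambda>s. ?\<phi> (x s))"
      by (auto simp: \<alpha>_def)
    have \<phi>: "smooth_on ?\<phi> ?T"
      using smooth_on_transition[OF atlas cA(1) dA] .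
    have T: "open ?T"
      using open_cmap_image[OF atlas cA(1) open_cdom[OF atlas dA]] .
    have K: "open ?K"
      using cont_\<alpha> open_cdom[OF atlas dA] by (auto simp: continuous_on_open_vimage Int_commute)
    have xT: "x t \<in> ?T" if "t \<in> ?K" for t
      using that \<alpha>_dom[of t] by (auto simp: charts_at_def intro!: image_eqI[of _ _ "\<alpha> t"])
    show "smooth_on ?y ?K"
      unfolding y using smooth_x xT
      by (intro smooth_on_compose[OF K \<phi>]) (auto intro: smooth_on_subset)
    have y': "(?y has_vector_derivative D ?\<phi> (x t) (v t)) (at t)" if "t \<in> ?K" for t
      using has_derivative_compose[OF x'[unfolded has_vector_derivative_def]
          smooth_on_has_derivative[OF \<phi> xT[OF that]]] smooth_on_linear_D[OF \<phi> xT[OF that]] that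
      unfolding y by (simp add: has_vector_derivative_def linear_scale)
    fix t assume t: "t \<in> ?K"
    show "vector_derivative ?y (at t) = D ?\<phi> (x t) (v t)"
      using y'[OF t] by (rule vector_derivative_at)
    let ?b = "D ?\<phi> (x t) (acc (x t, v t)) + D (\<lambda>y. D ?\<phi> y (v t)) (x t) (v t)"
    have tJ: "t \<in> ?J"
      using t by simp
    have "((\<lambda>s. D ?\<phi> (x s) (v s)) has_vector_derivative ?b) (at t)"
      using has_vector_derivative_D[OF T xT[OF t] \<phi> x'[OF tJ] v'[OF tJ]] .
    then have "((\<lambda>s. vector_derivative ?y (at s)) has_vector_derivative ?b) (at t)"
      by (rule has_vector_derivative_transform_within_open[OF _ K t])
        (use y' vector_derivative_at in metis)
    then have b: "vector_derivative (\<lambda>s. vector_derivative ?y (at s)) (at t) = ?b"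
      by (rule vector_derivative_at)
    have d: "d \<in> charts_at A (\<alpha> t)"
      using dA t by (simp add: charts_at_def)
    have "euler_lagrange (G d) (cmap d (\<alpha> t)) (D ?\<phi> (x t) (v t)) ?b w = 0" for w
    proof -
      \<comment> \<open>Naturality only reaches test vectors in the image of the derivative of the
        transition map; the reverse transition shows that this is every \<open>w\<close>.\<close>
      have "w = D ?\<phi> (x t) (D (cmap c \<circ> cinv d) (cmap d (\<alpha> t)) w)"
        using D_chart_self[OF atlas d, of w]
          D_chart_change[OF atlas d \<alpha>_dom(1)[OF tJ] transition_differentiable[OF atlas \<alpha>_dom(1)[OF tJ] d], of w]
        by (simp add: \<alpha>_dom(2)[OF tJ])
      then obtain w' where w': "w = D ?\<phi> (x t) w'"
        by blast
      have "?\<phi> ` ?T \<subseteq> cmap d ` cdom d"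
        using cinv_cmap[OF atlas cA(1)] by auto
      moreover have "transpose (G d y) = G d y" if "y \<in> cmap d ` cdom d" for y
        using posdef_G[of d] that dA by (auto simp: posdef_def charts_at_def)
      ultimately have "euler_lagrange (pullback ?\<phi> (G d)) (x t) (v t) (acc (x t, v t)) w'
          = euler_lagrange (G d) (?\<phi> (x t)) (D ?\<phi> (x t) (v t)) ?b w"
        unfolding w' by (rule euler_lagrange_pullback[OF T xT[OF t] \<phi> smooth_on_G[OF dA]])
      moreover have "euler_lagrange (G c) (x t) = euler_lagrange (pullback ?\<phi> (G d)) (x t)"
        using G_differentiable[OF \<alpha>_dom(1)[OF tJ]] \<alpha>_dom(2)[OF tJ]
        by (intro euler_lagrange_cong[OF T xT[OF t] G_chart_change[OF cA(1) dA]]) simp_all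
      ultimately show ?thesis
        using el[OF tJ, of w'] by (simp add: \<alpha>_def)
    qed
    then show "\<forall>k. vector_derivative (\<lambda>s. vector_derivative ?y (at s)) (at t) $ k
         + (\<Sum>i\<in>UNIV. \<Sum>j\<in>UNIV. christoffel A g d (cmap d (\<alpha> t)) k i j
              * vector_derivative ?y (at t) $ i * vector_derivative ?y (at t) $ j) = 0"
      unfolding b vector_derivative_at[OF y'[OF t]]
      by (subst geodesic_equation_iff_euler_lagrange[OF G_differentiable[OF d] posdef_G[OF d]]) blast
  qed
  have "geodesic_on A g ?J \<alpha>"
    unfolding geodesic_on_def using cont_\<alpha> chart is_interval_oo open_greaterThanLessThan by blast
  moreover have "\<alpha> 0 = p"
    using z0 cinv_cmap[OF atlas cA] by (simp add: \<alpha>_def x_def)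
  moreover have "vector_derivative (cmap c \<circ> \<alpha>) (at 0) = u"
  proof -
    have "0 \<in> ?J \<inter> \<alpha> -` cdom c"
      using e cA \<open>\<alpha> 0 = p\<close> by simp
    then have "vector_derivative (cmap c \<circ> \<alpha>) (at 0) = D (cmap c \<circ> cinv c) (x 0) (v 0)"
      using chart[OF cA(1)] by blast
    then show ?thesis
      using z0 D_chart_self[OF atlas c, of u] by (simp add: x_def v_def)
  qed
  ultimately show ?thesis
    using e by (intro that[of e \<alpha>])
qed

lemma velocity_eq_tlift:
  assumes \<alpha>: "geodesic_on A g I \<alpha>" and t: "t \<in> I" and c: "c \<in> charts_at A (\<alpha> t)"
  shows "velocity A \<alpha> t = tlift A c (\<alpha> t) (vector_derivative (cmap c \<circ> \<alpha>) (at t))"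
proof
  fix d
  let ?u = "vector_derivative (cmap c \<circ> \<alpha>) (at t)"
  have "vector_derivative (cmap d \<circ> \<alpha>) (at t) = D (cmap d \<circ> cinv c) (cmap c (\<alpha> t)) ?u"
    if d: "d \<in> charts_at A (\<alpha> t)"
  proof (rule vector_derivative_at)
    have T: "(cmap d \<circ> cinv c has_derivative D (cmap d \<circ> cinv c) (cmap c (\<alpha> t))) (at ((cmap c \<circ> \<alpha>) t))"
      using transition_differentiable[OF atlas c d] unfolding frechet_derivative_works by simp
    then have "linear (D (cmap d \<circ> cinv c) (cmap c (\<alpha> t)))"
      using has_derivative_bounded_linear bounded_linear.linear by blast
    moreover note has_derivative_compose[OF geodesic_position[OF \<alpha> t c, unfolded has_vector_derivative_def] T]
    ultimately have "((\<lambda>s. (cmap d \<circ> cinv c) ((cmap c \<circ> \<alpha>) s)) has_vector_derivative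
        D (cmap d \<circ> cinv c) (cmap c (\<alpha> t)) ?u) (at t)"
      by (simp add: has_vector_derivative_def linear_scale)
    then show "(cmap d \<circ> \<alpha> has_vector_derivative D (cmap d \<circ> cinv c) (cmap c (\<alpha> t)) ?u) (at t)"
      by (rule has_vector_derivative_transform_within_open[OF _ geodesic_chart_domain[OF \<alpha> t c]])
        (use t c cinv_cmap[OF atlas] in \<open>auto simp: charts_at_def\<close>)
  qed
  then show "velocity A \<alpha> t d = tlift A c (\<alpha> t) ?u d"
    by (simp add: velocity_def tlift_def)
qed

lemma velocity_in_tangent_space:
  "geodesic_on A g I \<alpha> \<Longrightarrow> t \<in> I \<Longrightarrow> velocity A \<alpha> t \<in> tangent_space A (\<alpha> t)"
  using charts_at_nonempty[OF atlas, of "\<alpha> t"] velocity_eq_tlift[of I \<alpha> t]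
    tlift_in_tangent_space[OF atlas] by metis

text \<open>In a chart the derivative of g(u, u) along the curve is twice the Euler--Lagrange
  expression tested against \<open>w = u\<close>. This is local in \<open>t\<close>, and
  \<open>I\<close> is an interval.\<close>

lemma energy_constant:
  assumes \<alpha>: "geodesic_on A g I \<alpha>"
  shows "(\<lambda>t. g (\<alpha> t) (velocity A \<alpha> t) (velocity A \<alpha> t)) constant_on I"
proof -
  let ?E = "\<lambda>t. g (\<alpha> t) (velocity A \<alpha> t) (velocity A \<alpha> t)"
  have "(?E has_real_derivative 0) (at t)" if t: "t \<in> I" for t
  proof -
    obtain c where c: "c \<in> charts_at A (\<alpha> t)"
      using charts_at_nonempty[OF atlas] by blast
    let ?x = "cmap c \<circ> \<alpha>"
    let ?u = "\<lambda>s. vector_derivative ?x (at s)"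
    let ?a = "vector_derivative ?u (at t)"
    have "(G c has_derivative D (G c) (?x t)) (at (?x t))"
      using G_differentiable[OF c] by (simp add: frechet_derivative_works)
    note deriv = has_real_derivative_form[OF this geodesic_position[OF \<alpha> t c]
        geodesic_velocity[OF \<alpha> t c] geodesic_velocity[OF \<alpha> t c]]
    have "form (G c (?x t)) ?a (?u t) + form (D (G c) (?x t) (?u t)) (?u t) (?u t)
        + form (G c (?x t)) (?u t) ?a = 2 * euler_lagrange (G c) (?x t) (?u t) ?a (?u t)"
      using posdef_form_commute[OF posdef_G[OF c], of ?a "?u t"] by (simp add: euler_lagrange_def)
    then have "form (G c (?x t)) ?a (?u t) + form (D (G c) (?x t) (?u t)) (?u t) (?u t)
        + form (G c (?x t)) (?u t) ?a = 0"
      by (simp only: geodesic_euler_lagrange[OF \<alpha> t c] mult_zero_right)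
    with deriv have "((\<lambda>s. form (G c (?x s)) (?u s) (?u s)) has_real_derivative 0) (at t)"
      by (simp only:)
    then show ?thesis
    proof (rule has_field_derivative_transform_within_open[OF _ geodesic_chart_domain[OF \<alpha> t c]])
      show "t \<in> I \<inter> \<alpha> -` cdom c"
        using t c by (simp add: charts_at_def)
      fix s assume "s \<in> I \<inter> \<alpha> -` cdom c"
      then have "s \<in> I" "c \<in> charts_at A (\<alpha> s)"
        using c by (auto simp: charts_at_def)
      from velocity_eq_tlift[OF \<alpha> this] g_tlift[OF this(2)]
      show "form (G c (?x s)) (?u s) (?u s) = ?E s"
        by simp
    qed
  qed
  then have "(?E has_derivative (\<lambda>h. 0)) (at t within I)" if "t \<in> I" for t
    using that by (auto simp: has_real_derivative_iff_has_vector_derivative has_vector_derivative_def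
        intro: has_derivative_at_withinI)
  moreover have "convex I"
    using \<alpha> by (simp add: geodesic_on_def is_interval_convex)
  ultimately show ?thesis
    unfolding constant_on_def by (intro has_derivative_zero_constant)
qed

lemma g_tzero: "g p tzero tzero = 0"
proof -
  obtain c where c: "c \<in> charts_at A p"
    using charts_at_nonempty[OF atlas] by blast
  from g_tlift[OF c, of 0 0] tlift_eq_tzero_iff[OF atlas c, of 0] show ?thesis
    by simp
qed

text \<open>A zero velocity would have energy 0, contrary to conservation of energy and definiteness
  at time \<open>t\<close>.\<close>

lemma velocity_nonzero:
  assumes \<alpha>: "geodesic_on A g I \<alpha>" and t: "t \<in> I" "velocity A \<alpha> t \<noteq> tzero" and s: "s \<in> I"
  shows "velocity A \<alpha> s \<noteq> tzero"
proof
  assume "velocity A \<alpha> s = tzero"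
  with energy_constant[OF \<alpha>] s t(1) have "g (\<alpha> t) (velocity A \<alpha> t) (velocity A \<alpha> t) = 0"
    unfolding constant_on_def using g_tzero by metis
  with g_pos[OF velocity_in_tangent_space[OF \<alpha> t(1)] t(2)] show False
    by simp
qed

end

section \<open>Conformal submersions in charts\<close>

lemma horizontal_space_conformal_metric:
  assumes "\<And>p. dil p > 0"
  shows "horizontal_space A (conformal_metric dil g) B F p = horizontal_space A g B F p"
proof -
  have "dil p \<noteq> 0"
    using assms[of p] by simp
  then show ?thesis
    by (simp add: horizontal_space_def conformal_metric_def)
qed

lemma angle_to_subspace_conformal_metric:
  assumes "\<And>p. dil p > 0"
  shows "angle_to_subspace (conformal_metric dil g) p v H = angle_to_subspace g p v H"
proof -
  have "dil p > 0"
    using assms .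
  then have "(dil p)\<^sup>2 * a / (sqrt ((dil p)\<^sup>2 * b) * sqrt ((dil p)\<^sup>2 * d)) = a / (sqrt b * sqrt d)" for a b d
    by (simp add: real_sqrt_mult power2_eq_square)
  then show ?thesis
    by (simp add: angle_to_subspace_def conformal_metric_def)
qed

locale conformal_submersion_in_charts =
  M: metric_in_charts A g + B: metric_in_charts B g'
  for A :: "('a::{t2_space,second_countable_topology}, 'd::finite) chart set" and g
    and B :: "('b::{t2_space,second_countable_topology}, 'e::finite) chart set" and g' +
  fixes F :: "'a \<Rightarrow> 'b" and dil :: "'a \<Rightarrow> real"
  assumes conformal: "conformal_submersion A g B g' F dil"
begin

abbreviation "\<phi> c d \<equiv> cmap d \<circ> F \<circ> cinv c"

abbreviation "sq_dil c x \<equiv> (dil (cinv c x))\<^sup>2"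

abbreviation "DF c d p \<equiv> D (\<phi> c d) (cmap c p)"

abbreviation "g\<^sub>c c p \<equiv> form (M.G c (cmap c p))"

text \<open>In coordinates \<open>N\<close> is \<open>\<lambda>\<^sup>2 g - F\<^sup>*g'\<close>, that is \<open>\<lambda>\<^sup>2 g\<close> of the vertical components.\<close>

definition "N c d x = sq_dil c x *\<^sub>R M.G c x - pullback (\<phi> c d) (B.G d) x"

lemma dil_pos: "dil p > 0"
  using conformal by (simp add: conformal_submersion_def)

lemma smooth_map_F: "smooth_map A B F"
  using conformal by (simp add: conformal_submersion_def submersion_def)

lemma open_F_domain:
  assumes "c \<in> A" "d \<in> B"
  shows "open (cmap c ` (cdom c \<inter> F -` cdom d))"
proof -
  have "open (F -` cdom d)"
    using smooth_map_F open_cdom[OF B.atlas assms(2)]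
    by (simp add: smooth_map_def continuous_on_open_vimage)
  then show ?thesis
    using open_cmap_image[OF M.atlas assms(1)] by blast
qed

lemma smooth_on_\<phi>: "c \<in> A \<Longrightarrow> d \<in> B \<Longrightarrow> smooth_on (\<phi> c d) (cmap c ` (cdom c \<inter> F -` cdom d))"
  using smooth_map_F by (simp add: smooth_map_def)

lemma smooth_on_sq_dil: "c \<in> A \<Longrightarrow> smooth_on (sq_dil c) (cmap c ` cdom c)"
  using conformal open_cmap_cdom[OF M.atlas, of c]
    smooth_on_mult[of "cmap c ` cdom c" "dil \<circ> cinv c" "dil \<circ> cinv c"]
  by (simp add: conformal_submersion_def smooth_fun_def power2_eq_square)

lemma smooth_on_N:
  assumes "c \<in> A" "d \<in> B"
  shows "smooth_on (N c d) (cmap c ` (cdom c \<inter> F -` cdom d))"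
proof -
  let ?S = "cmap c ` (cdom c \<inter> F -` cdom d)"
  have S: "open ?S"
    using open_F_domain[OF assms] .
  have "\<phi> c d ` ?S \<subseteq> cmap d ` cdom d"
    using cinv_cmap[OF M.atlas assms(1)] by auto
  from smooth_on_pullback[OF S smooth_on_\<phi>[OF assms] B.smooth_on_G[OF assms(2)] this]
  have "smooth_on (pullback (\<phi> c d) (B.G d)) ?S" .
  moreover have "smooth_on (sq_dil c) ?S" "smooth_on (M.G c) ?S"
    using smooth_on_sq_dil[OF assms(1)] M.smooth_on_G[OF assms(1)] by (auto intro: smooth_on_subset)
  ultimately show ?thesis
    unfolding smooth_on_def N_def[abs_def] by (intro allI Ck_on_diff[OF S Ck_on_scaleR[OF S]]) simp_all
qed

text \<open>By naturality the test vector enters only through its image under the derivative of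
  \<open>\<phi> c d\<close>, which is 0, and the Euler--Lagrange expression is linear in the test
  vector.\<close>

lemma euler_lagrange_pullback_vertical:
  assumes "c \<in> A" "d \<in> B" "x \<in> cmap c ` (cdom c \<inter> F -` cdom d)" "D (\<phi> c d) x w = 0"
  shows "euler_lagrange (pullback (\<phi> c d) (B.G d)) x u a w = 0"
proof -
  have im: "\<phi> c d ` cmap c ` (cdom c \<inter> F -` cdom d) \<subseteq> cmap d ` cdom d"
    using cinv_cmap[OF M.atlas assms(1)] by auto
  have "transpose (B.G d y) = B.G d y" if "y \<in> cmap d ` cdom d" for y
    using B.posdef_G[of d] that assms(2) by (auto simp: posdef_def charts_at_def)
  note el = euler_lagrange_pullback[OF open_F_domain[OF assms(1,2)] assms(3) smooth_on_\<phi>[OF assms(1,2)]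
      B.smooth_on_G[OF assms(2)] im this, of u a w]
  have "\<phi> c d x \<in> cmap d ` cdom d"
    using im assms(3) by blast
  then have "D (B.G d) (\<phi> c d x) 0 = 0"
    by (rule linear_0[OF smooth_on_linear_D[OF B.smooth_on_G[OF assms(2)]]])
  then show ?thesis
    by (simp only: el assms(4)) (simp add: euler_lagrange_def)
qed

context
  fixes p c d
  assumes c: "c \<in> charts_at A p" and d: "d \<in> charts_at B (F p)"
begin

lemma cA: "c \<in> A" "p \<in> cdom c" and dB: "d \<in> B" "F p \<in> cdom d"
  using c d by (auto simp: charts_at_def)

lemma cinv_cmap_p: "cinv c (cmap c p) = p"
  using cinv_cmap[OF M.atlas cA] .

lemma cmap_in_F_domain: "cmap c p \<in> cmap c ` (cdom c \<inter> F -` cdom d)"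
  using cA dB by blast

lemma has_derivative_\<phi>: "(\<phi> c d has_derivative (DF c d p)) (at (cmap c p))"
  using smooth_on_has_derivative[OF smooth_on_\<phi>[OF cA(1) dB(1)] cmap_in_F_domain] .

lemma linear_DF: "linear (DF c d p)"
  using smooth_on_linear_D[OF smooth_on_\<phi>[OF cA(1) dB(1)] cmap_in_F_domain] .

end

text \<open>This frees \<open>differential\<close> from its arbitrarily chosen chart: the chain rule
  is applied once in the source, from the chosen chart to \<open>c\<close>, and once in the target,
  from \<open>d\<close> to each chart \<open>e\<close>.\<close>

lemma differential_tlift:
  assumes c: "c \<in> charts_at A p" and d: "d \<in> charts_at B (F p)"
  shows "differential A B F p (tlift A c p u) = tlift B d (F p) (D (\<phi> c d) (cmap c p) u)"
proof
  fix e
  show "differential A B F p (tlift A c p u) e = tlift B d (F p) (D (\<phi> c d) (cmap c p) u) e"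
  proof (cases "e \<in> charts_at B (F p)")
    case e: True
    define c' where "c' = (SOME c. c \<in> charts_at A p)"
    have c': "c' \<in> charts_at A p"
      unfolding c'_def using c by (rule someI)
    have "differential A B F p (tlift A c p u) e
        = D (\<phi> c' e) (cmap c' p) (D (cmap c' \<circ> cinv c) (cmap c p) u)"
      using e c' by (simp add: differential_def c'_def[symmetric] tlift_def)
    also have "\<dots> = D (\<phi> c e) (cmap c p) u"
      using D_chart_change[OF M.atlas c c' differentiableI[OF has_derivative_\<phi>[OF c' e]]] by (rule sym)
    also have "\<phi> c d (cmap c p) = cmap d (F p)"
      using cinv_cmap_p[OF c d] by simp
    then have "(cmap e \<circ> cinv d has_derivative D (cmap e \<circ> cinv d) (cmap d (F p))) (at (\<phi> c d (cmap c p)))"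
      using transition_differentiable[OF B.atlas d e] by (simp add: frechet_derivative_works)
    from diff_chain_at[OF has_derivative_\<phi>[OF c d] this]
    have "(\<phi> c e has_derivative D (cmap e \<circ> cinv d) (cmap d (F p)) \<circ> D (\<phi> c d) (cmap c p)) (at (cmap c p))"
      using open_F_domain[OF cA(1)[OF c d] dB(1)[OF c d]] cmap_in_F_domain[OF c d]
      by (rule has_derivative_transform_within_open)
        (use cinv_cmap[OF M.atlas cA(1)[OF c d]] cinv_cmap[OF B.atlas dB(1)[OF c d]] in auto)
    from frechet_derivative_at[OF this]
    have "D (\<phi> c e) (cmap c p) u = D (cmap e \<circ> cinv d) (cmap d (F p)) (D (\<phi> c d) (cmap c p) u)"
      by (metis comp_apply)
    finally show ?thesis
      using e by (simp add: tlift_def)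
  qed (simp add: differential_def tlift_def)
qed

context
  fixes p c d
  assumes c: "c \<in> charts_at A p" and d: "d \<in> charts_at B (F p)"
begin

lemma form_N:
  "form (N c d (cmap c p)) u v
    = (dil p)\<^sup>2 * g\<^sub>c c p u v - form (B.G d (cmap d (F p))) (DF c d p u) (DF c d p v)"
  using form_pullback[OF linear_DF[OF c d]] cinv_cmap_p[OF c d]
  by (simp add: N_def algebra_simps inner_diff_right scaleR_matrix_vector_assoc[symmetric])

lemma form_N_tlift:
  "form (N c d (cmap c p)) u v = (dil p)\<^sup>2 * g p (tlift A c p u) (tlift A c p v)
    - g' (F p) (differential A B F p (tlift A c p u)) (differential A B F p (tlift A c p v))"
  by (simp add: form_N M.g_tlift[OF c] differential_tlift[OF c d] B.g_tlift[OF d])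

lemma form_N_commute: "form (N c d (cmap c p)) u v = form (N c d (cmap c p)) v u"
  unfolding form_N
  using posdef_form_commute[OF M.posdef_G[OF c]] posdef_form_commute[OF B.posdef_G[OF d]] by metis

lemma vertical_space_tlift: "vertical_space A B F p = tlift A c p ` {v. DF c d p v = 0}"
  by (auto simp: vertical_space_def tangent_space_eq_image[OF M.atlas c] differential_tlift[OF c d]
      tlift_eq_tzero_iff[OF B.atlas d])

lemma horizontal_space_tlift:
  "horizontal_space A g B F p = tlift A c p ` {u. \<forall>v. DF c d p v = 0 \<longrightarrow> g\<^sub>c c p v u = 0}"
  using posdef_form_commute[OF M.posdef_G[OF c]]
  by (auto simp: horizontal_space_def tangent_space_eq_image[OF M.atlas c] vertical_space_tlift
      M.g_tlift[OF c])

lemma vertical_part: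
  obtains v where "DF c d p v = 0" "\<And>w. DF c d p w = 0 \<Longrightarrow> g\<^sub>c c p w (u - v) = 0"
proof -
  have "subspace {v. DF c d p v = 0}"
    using linear_subspace_kernel[OF linear_DF[OF c d]] .
  from posdef_orthogonal_decomposition[OF M.posdef_G[OF c] this, of u]
  obtain v where "v \<in> {v. DF c d p v = 0}" "\<And>w. w \<in> {v. DF c d p v = 0} \<Longrightarrow> g\<^sub>c c p w (u - v) = 0"
    by blast
  then show ?thesis
    by (intro that[of v]) simp_all
qed

lemma form_horizontal:
  assumes "\<And>w. DF c d p w = 0 \<Longrightarrow> g\<^sub>c c p w u = 0" "\<And>w. DF c d p w = 0 \<Longrightarrow> g\<^sub>c c p w v = 0"
  shows "form (B.G d (cmap d (F p))) (DF c d p u) (DF c d p v) = (dil p)\<^sup>2 * g\<^sub>c c p u v"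
proof -
  have "tlift A c p u \<in> horizontal_space A g B F p" "tlift A c p v \<in> horizontal_space A g B F p"
    using assms by (auto simp: horizontal_space_tlift)
  then have "g' (F p) (differential A B F p (tlift A c p u)) (differential A B F p (tlift A c p v))
      = (dil p)\<^sup>2 * g p (tlift A c p u) (tlift A c p v)"
    using conformal by (simp add: conformal_submersion_def)
  then show ?thesis
    by (simp add: M.g_tlift[OF c] differential_tlift[OF c d] B.g_tlift[OF d])
qed

text \<open>The pullback of \<open>g'\<close> sees only the horizontal parts of \<open>u\<close> and
  \<open>b\<close>, and on these it is \<lambda>^2 g by conformality. Subtracting it from
  \<lambda>^2 g leaves the pairing with the vertical part \<open>v\<close> of
  \<open>u\<close>.\<close>

lemma form_N_vertical_part:
  assumes v: "DF c d p v = 0" "\<And>w. DF c d p w = 0 \<Longrightarrow> g\<^sub>c c p w (u - v) = 0"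
  shows "form (N c d (cmap c p)) u b = (dil p)\<^sup>2 * g\<^sub>c c p v b"
proof -
  obtain b' where b': "DF c d p b' = 0" "\<And>w. DF c d p w = 0 \<Longrightarrow> g\<^sub>c c p w (b - b') = 0"
    using vertical_part by blast
  have "DF c d p u = DF c d p (u - v)" "DF c d p b = DF c d p (b - b')"
    using linear_diff[OF linear_DF[OF c d]] v(1) b'(1) by simp_all
  then have "form (N c d (cmap c p)) u b = (dil p)\<^sup>2 * (g\<^sub>c c p u b - g\<^sub>c c p (u - v) (b - b'))"
    using form_horizontal[OF v(2) b'(2)] by (simp add: form_N right_diff_distrib)
  moreover have "g\<^sub>c c p (u - v) b' = 0"
    using v(2)[OF b'(1)] posdef_form_commute[OF M.posdef_G[OF c]] by metis
  ultimately show ?thesis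
    by (simp add: algebra_simps inner_diff_left)
qed

lemma form_N_nonneg: "form (N c d (cmap c p)) u u \<ge> 0"
  and form_N_eq_0: "form (N c d (cmap c p)) u u = 0 \<Longrightarrow> form (N c d (cmap c p)) u b = 0"
proof -
  obtain v where v: "DF c d p v = 0" "\<And>w. DF c d p w = 0 \<Longrightarrow> g\<^sub>c c p w (u - v) = 0"
    using vertical_part by blast
  have "g\<^sub>c c p v u = g\<^sub>c c p v v"
    using v(2)[OF v(1)] by (simp add: algebra_simps inner_diff_right)
  with form_N_vertical_part[OF v, of u] have N: "form (N c d (cmap c p)) u u = (dil p)\<^sup>2 * g\<^sub>c c p v v"
    by simp
  then show "form (N c d (cmap c p)) u u \<ge> 0"
    using posdef_form_nonneg[OF M.posdef_G[OF c]] by simp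
  \<comment> \<open>The form is semidefinite, not definite: a null vector has zero vertical part and
    is therefore in the kernel of the whole form.\<close>
  assume "form (N c d (cmap c p)) u u = 0"
  then have "v = 0"
    using N posdef_form_eq_0[OF M.posdef_G[OF c]] dil_pos[of p] by simp
  then show "form (N c d (cmap c p)) u b = 0"
    using form_N_vertical_part[OF v, of b] by simp
qed

text \<open>The index type of the coordinates of the base is nonempty, so
  \<open>axis undefined 1\<close> is a nonzero target; a preimage exists by surjectivity of the
  differential, and its horizontal part is nonzero. This makes the infimum in
  \<open>angle_to_subspace\<close> range over a nonempty set.\<close>

lemma horizontal_vector_exists:
  obtains u where "u \<noteq> 0" "\<And>w. DF c d p w = 0 \<Longrightarrow> g\<^sub>c c p w u = 0"
proof -
  have "tlift B d (F p) (axis undefined 1) \<in> differential A B F p ` tangent_space A p"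
    using conformal tlift_in_tangent_space[OF B.atlas d]
    by (simp add: conformal_submersion_def submersion_def)
  then obtain E where "tlift B d (F p) (axis undefined 1) = tlift B d (F p) (DF c d p E)"
    by (auto simp: tangent_space_eq_image[OF M.atlas c] differential_tlift[OF c d])
  then have "DF c d p E \<noteq> 0"
    using tlift_self[OF B.atlas d] by (metis axis_eq_0_iff zero_neq_one)
  moreover obtain v where v: "DF c d p v = 0" "\<And>w. DF c d p w = 0 \<Longrightarrow> g\<^sub>c c p w (E - v) = 0"
    using vertical_part by blast
  ultimately have "E - v \<noteq> 0"
    by auto
  then show ?thesis
    using v(2) that by blast
qed

end

section \<open>The angle with the horizontal space\<close>

text \<open>By Cauchy--Schwarz the infimum is attained at the horizontal part of \<open>u\<close>.
  The cosine is then the length of the horizontal part over that of \<open>u\<close>, so the squared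
  sine is the corresponding ratio for the vertical part, which \<open>form_N_vertical_part\<close>
  expresses by \<open>N\<close>.\<close>

lemma angle_to_horizontal_space:
  assumes c: "c \<in> charts_at A p" and d: "d \<in> charts_at B (F p)" and "u \<noteq> 0"
  shows "sin (angle_to_subspace g p (tlift A c p u) (horizontal_space A g B F p))
    = sqrt (form (N c d (cmap c p)) u u / ((dil p)\<^sup>2 * form (M.G c (cmap c p)) u u))"
proof -
  let ?L = "D (\<phi> c d) (cmap c p)" and ?g = "form (M.G c (cmap c p))"
  note pos = M.posdef_G[OF c]
  obtain v where v: "?L v = 0" "\<And>w. ?L w = 0 \<Longrightarrow> ?g w (u - v) = 0"
    using vertical_part[OF c d] by blast
  define X where "X = u - v"
  have gv: "?g v u = ?g v v" and gu: "?g u u = ?g v v + ?g X X"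
    using v(2)[OF v(1)] posdef_form_commute[OF pos, of u v]
    by (simp_all add: X_def algebra_simps inner_diff_right inner_diff_left)
  have u_pos: "?g u u > 0"
    using pos \<open>u \<noteq> 0\<close> by (simp add: posdef_def)
  \<comment> \<open>The cosine of the angle, as will be shown.\<close>
  define R where "R = sqrt (?g X X) / sqrt (?g u u)"
  have R: "0 \<le> R" "R \<le> 1" "R\<^sup>2 = ?g X X / ?g u u"
    using u_pos gu posdef_form_nonneg[OF pos] by (auto simp: R_def power_divide)
  let ?H = "{h. h \<noteq> 0 \<and> (\<forall>w. ?L w = 0 \<longrightarrow> ?g w h = 0)}"
  let ?r = "\<lambda>h. ?g u h / (sqrt (?g u u) * sqrt (?g h h))"
  have "horizontal_space A g B F p - {tzero} = tlift A c p ` ?H"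
    by (auto simp: horizontal_space_tlift[OF c d] tlift_eq_tzero_iff[OF M.atlas c])
  then have angle: "angle_to_subspace g p (tlift A c p u) (horizontal_space A g B F p)
      = Inf ((\<lambda>h. arccos (?r h)) ` ?H)"
    by (simp add: angle_to_subspace_def image_image M.g_tlift[OF c])
  have bounds: "- 1 \<le> ?r h" "?r h \<le> R" if "h \<in> ?H" for h
  proof -
    have "?g v h = 0"
      using that v(1) by blast
    then have "?g u h = ?g X h"
      by (simp add: X_def inner_diff_left)
    then have le: "\<bar>?g u h\<bar> \<le> sqrt (?g X X) * sqrt (?g h h)"
      using posdef_Cauchy_Schwarz[OF pos] by simp
    have h_pos: "?g h h > 0"
      using that pos by (simp add: posdef_def)
    have "\<bar>?r h\<bar> = \<bar>?g u h\<bar> / (sqrt (?g u u) * sqrt (?g h h))"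
      using u_pos h_pos by (simp add: abs_mult)
    also have "\<dots> \<le> sqrt (?g X X) * sqrt (?g h h) / (sqrt (?g u u) * sqrt (?g h h))"
      using le u_pos h_pos by (intro divide_right_mono) auto
    also have "\<dots> = R"
      using h_pos by (simp add: R_def)
    finally have "\<bar>?r h\<bar> \<le> R" .
    then show "- 1 \<le> ?r h" "?r h \<le> R"
      using R(2) by linarith+
  qed
  have "\<exists>h\<in>?H. ?r h = R"
  proof (cases "X = 0")
    \<comment> \<open>Here \<open>u\<close> is vertical and every quotient is 0, so any nonzero
      horizontal vector attains the bound.\<close>
    case True
    obtain h where h: "h \<noteq> 0" "\<And>w. ?L w = 0 \<Longrightarrow> ?g w h = 0"
      using horizontal_vector_exists[OF c d] by blast
    moreover have "?r h = R"
      using h(2)[OF v(1)] True by (simp add: R_def X_def)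
    ultimately show ?thesis
      by blast
  next
    case False
    then have "X \<in> ?H"
      using v(2) by (simp add: X_def)
    moreover have "?g u X = ?g X X"
      using v(2)[OF v(1)] by (simp add: X_def inner_diff_left)
    then have "?r X = ?g X X / sqrt (?g X X) / sqrt (?g u u)"
      by (simp add: mult.commute)
    then have "?r X = R"
      unfolding R_def real_div_sqrt[OF posdef_form_nonneg[OF pos]] .
    ultimately show ?thesis
      by blast
  qed
  then obtain h where h: "h \<in> ?H" "?r h = R"
    by blast
  have "Inf ((\<lambda>h. arccos (?r h)) ` ?H) = arccos R"
  proof (rule cInf_eq_minimum)
    show "arccos R \<in> (\<lambda>h. arccos (?r h)) ` ?H"
      using h by (metis (no_types, lifting) image_eqI)
    show "arccos R \<le> y" if "y \<in> (\<lambda>h. arccos (?r h)) ` ?H" for y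
      using that bounds R by (auto intro!: arccos_le_arccos)
  qed
  moreover have "1 - R\<^sup>2 = form (N c d (cmap c p)) u u / ((dil p)\<^sup>2 * ?g u u)"
  proof -
    have "1 - R\<^sup>2 = ?g v v / ?g u u"
      using u_pos gu by (simp add: R(3) diff_divide_eq_iff)
    then show ?thesis
      using form_N_vertical_part[OF c d v, of u] gv dil_pos[of p] by simp
  qed
  ultimately show ?thesis
    using R by (simp add: angle sin_arccos)
qed

text \<open>The norm of \<open>tzero\<close> in the denominator makes each quotient 0 by the
  convention on division, so all the angles are \<open>arccos 0\<close>, and there is at least one
  of them.\<close>

lemma angle_tzero:
  "sin (angle_to_subspace g p tzero (horizontal_space A g B F p)) = 1"
proof -
  obtain c d where c: "c \<in> charts_at A p" and d: "d \<in> charts_at B (F p)"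
    using charts_at_nonempty M.atlas B.atlas by metis
  obtain u where u: "u \<noteq> 0" "\<And>w. D (\<phi> c d) (cmap c p) w = 0 \<Longrightarrow> form (M.G c (cmap c p)) w u = 0"
    using horizontal_vector_exists[OF c d] by blast
  then have "horizontal_space A g B F p - {tzero} \<noteq> {}"
    using tlift_eq_tzero_iff[OF M.atlas c] by (auto simp: horizontal_space_tlift[OF c d])
  moreover have "g p tzero tzero = 0"
    using M.g_tlift[OF c, of 0 0] tlift_eq_tzero_iff[OF M.atlas c, of 0] by simp
  ultimately show ?thesis
    by (simp add: angle_to_subspace_def)
qed

section \<open>The rescaled metric and its Riemannian submersion\<close>

lemma riemannian_conformal_metric: "riemannian_manifold A (conformal_metric dil g)"
proof -
  have pos: "(dil p)\<^sup>2 > 0" for p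
    using dil_pos[of p] by simp
  have "smooth_on (\<lambda>x. metric_matrix A (conformal_metric dil g) c x $ i $ j) (cmap c ` cdom c)"
    if c: "c \<in> A" for c i j
    using smooth_on_mult[OF open_cmap_cdom[OF M.atlas c] smooth_on_sq_dil[OF c] M.smooth_on_G_nth[OF c]]
    by (simp add: metric_matrix_def conformal_metric_def)
  with M.metric pos show ?thesis
    unfolding riemannian_manifold_def riemannian_metric_def conformal_metric_def
    by (simp add: M.atlas algebra_simps)
qed

lemma conformal_metric_riemannian_submersion:
  "riemannian_submersion A (conformal_metric dil g) B g' F"
  using conformal
  by (simp add: riemannian_submersion_def conformal_submersion_def conformal_metric_def
      horizontal_space_conformal_metric[unfolded conformal_metric_def] smooth_fun_def comp_def smooth_on_const)

end

section \<open>Clairaut conformal submersions\<close>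

locale clairaut_in_charts = conformal_submersion_in_charts +
  fixes r :: "'a \<Rightarrow> real"
  assumes clairaut: "clairaut_condition A g B F r"
begin

lemma r_pos: "r p > 0"
  using clairaut by (simp add: clairaut_condition_def)

lemma clairaut_constant:
  assumes "geodesic_on A g I \<alpha>"
  obtains K where "\<And>t. t \<in> I \<Longrightarrow> r (\<alpha> t) * sin (angle_to_subspace g (\<alpha> t) (velocity A \<alpha> t)
      (horizontal_space A g B F (\<alpha> t))) = K"
  using clairaut assms unfolding clairaut_condition_def constant_on_def by metis

lemma geodesic_submersion_chart_domain:
  assumes "continuous_on I \<alpha>" "open I" "c \<in> A" "d \<in> B"
  shows "open (I \<inter> \<alpha> -` (cdom c \<inter> F -` cdom d))"
proof -
  have "open (F -` cdom d)"
    using smooth_map_F open_cdom[OF B.atlas assms(4)]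
    by (simp add: smooth_map_def continuous_on_open_vimage)
  then have "open (cdom c \<inter> F -` cdom d)"
    using open_cdom[OF M.atlas assms(3)] by blast
  then show ?thesis
    using assms by (metis continuous_on_open_vimage Int_commute)
qed

text \<open>A geodesic which is horizontal at one instant is horizontal throughout, because the Clairaut
  constant vanishes. Comparing its equation with the minimum \<open>0\<close> of \<open>y \<mapsto> N\<^sub>y(u, u)\<close> at \<open>y = x\<close>
  leaves only the derivative of the dilation.\<close>

lemma sq_dil_vertical_derivative:
  assumes c: "c \<in> charts_at A p" and d: "d \<in> charts_at B (F p)" and V: "DF c d p V = 0"
  shows "D (sq_dil c) (cmap c p) V = 0"
proof -
  let ?x0 = "cmap c p" and ?N = "N c d"
  note cA = cA[OF c d] and dB = dB[OF c d]
  let ?S = "cmap c ` (cdom c \<inter> F -` cdom d)"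
  have x0: "?x0 \<in> ?S"
    using cmap_in_F_domain[OF c d] .
  have S: "open ?S"
    using open_F_domain[OF cA(1) dB(1)] .
  obtain u where u: "u \<noteq> 0" "\<And>w. DF c d p w = 0 \<Longrightarrow> g\<^sub>c c p w u = 0"
    using horizontal_vector_exists[OF c d] by blast
  obtain e \<alpha> where e: "e > 0" and \<alpha>: "geodesic_on A g {-e<..<e} \<alpha>" and \<alpha>0: "\<alpha> 0 = p"
    and u0: "vector_derivative (cmap c \<circ> \<alpha>) (at 0) = u"
    using M.geodesic_exists[OF c, of u] by blast
  let ?I = "{-e<..<e}"
  define x where "x = cmap c \<circ> \<alpha>"
  define v where "v s = vector_derivative x (at s)" for s
  define a where "a = vector_derivative v (at 0)"
  have x0_eq: "x 0 = ?x0" and v0: "v 0 = u"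
    using \<alpha>0 u0 by (simp_all add: x_def v_def)
  have I0: "0 \<in> ?I" and c0: "c \<in> charts_at A (\<alpha> 0)"
    using e c \<alpha>0 by simp_all
  have x': "(x has_vector_derivative u) (at 0)"
    using M.geodesic_position[OF \<alpha> I0 c0] v0 by (simp add: x_def v_def)
  have v': "(v has_vector_derivative a) (at 0)"
    using M.geodesic_velocity[OF \<alpha> I0 c0] by (simp add: x_def v_def[abs_def] a_def)
  have elG: "euler_lagrange (M.G c) ?x0 u a V = 0"
    using M.geodesic_euler_lagrange[OF \<alpha> I0 c0, of V] \<alpha>0 u0 by (simp add: x_def v_def[abs_def] a_def)
  let ?J = "?I \<inter> \<alpha> -` (cdom c \<inter> F -` cdom d)"
  have J: "open ?J" "0 \<in> ?J"
    using geodesic_submersion_chart_domain[of ?I \<alpha> c d] \<alpha> cA dB e \<alpha>0 by (auto simp: geodesic_on_def)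
  have vel: "velocity A \<alpha> s = tlift A c (\<alpha> s) (v s)" if "s \<in> ?J" for s
    using M.velocity_eq_tlift[OF \<alpha>, of s c] that cA(1) by (simp add: x_def v_def charts_at_def)
  have "velocity A \<alpha> 0 \<noteq> tzero"
    using vel[OF J(2)] v0 u(1) tlift_eq_tzero_iff[OF M.atlas c0] by simp
  then have vel_nz: "velocity A \<alpha> s \<noteq> tzero" if "s \<in> ?I" for s
    using M.velocity_nonzero[OF \<alpha> I0] that by blast
  obtain K where K: "\<And>t. t \<in> ?I \<Longrightarrow> r (\<alpha> t) * sin (angle_to_subspace g (\<alpha> t) (velocity A \<alpha> t)
      (horizontal_space A g B F (\<alpha> t))) = K"
    using clairaut_constant[OF \<alpha>] by blast
  have "form (?N ?x0) u u = 0"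
    using form_N_vertical_part[OF c d, of 0 u u] u(2) linear_0[OF linear_DF[OF c d]] by simp
  then have "K = 0"
    using K[OF I0] vel[OF J(2)] v0 angle_to_horizontal_space[OF c d u(1)] \<alpha>0 by simp
  \<comment> \<open>With Clairaut constant 0 the sine vanishes along the curve; semidefiniteness of
    \<open>N\<close> then gives the vanishing against every \<open>w\<close>, which is what can be
    differentiated below.\<close>
  have zero: "form (?N (x s)) (v s) w = 0" if s: "s \<in> ?J" for s w
  proof -
    have cs: "c \<in> charts_at A (\<alpha> s)" and ds: "d \<in> charts_at B (F (\<alpha> s))"
      using s cA(1) dB(1) by (auto simp: charts_at_def)
    have "v s \<noteq> 0"
      using vel[OF s] vel_nz[of s] tlift_eq_tzero_iff[OF M.atlas cs] s by auto
    then have "g\<^sub>c c (\<alpha> s) (v s) (v s) > 0"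
      using M.posdef_G[OF cs] by (simp add: posdef_def)
    moreover have "sqrt (form (?N (x s)) (v s) (v s) / ((dil (\<alpha> s))\<^sup>2 * g\<^sub>c c (\<alpha> s) (v s) (v s))) = 0"
      using K[of s] vel[OF s] angle_to_horizontal_space[OF cs ds \<open>v s \<noteq> 0\<close>] s \<open>K = 0\<close> r_pos[of "\<alpha> s"]
      by (simp add: x_def)
    ultimately have "form (?N (x s)) (v s) (v s) = 0"
      using dil_pos[of "\<alpha> s"] by simp
    then show ?thesis
      using form_N_eq_0[OF cs ds] by (simp add: x_def)
  qed
  have N: "(?N has_derivative D ?N ?x0) (at ?x0)"
    using smooth_on_has_derivative[OF smooth_on_N[OF cA(1) dB(1)] x0] .
  have "((\<lambda>s. form (?N (x s)) (v s) V) has_real_derivative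
      form (?N ?x0) a V + form (D ?N ?x0 u) u V + form (?N ?x0) u 0) (at 0)"
    using has_real_derivative_form[OF N[folded x0_eq] x' v' has_vector_derivative_const] by (simp add: x0_eq v0)
  moreover have "((\<lambda>s. form (?N (x s)) (v s) V) has_real_derivative 0) (at 0)"
    by (rule has_field_derivative_transform_within_open[OF DERIV_const J]) (simp add: zero)
  \<comment> \<open>Up to symmetry these are the first two terms of the Euler--Lagrange expression
    of \<open>N\<close> tested against \<open>V\<close>; the minimum argument below disposes of the
    third.\<close>
  ultimately have curve: "form (?N ?x0) a V + form (D ?N ?x0 u) u V = 0"
    using DERIV_unique by fastforce
  have "(\<lambda>w. form (D ?N ?x0 w) u u) = (\<lambda>w. 0)"
  proof (rule differential_zero_maxmin[OF x0 S])
    show "((\<lambda>y. form (?N y) u u) has_derivative (\<lambda>w. form (D ?N ?x0 w) u u)) (at ?x0)"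
      using has_derivative_form[OF N has_derivative_const has_derivative_const] by simp
    have "form (?N ?x0) u u \<le> form (?N y) u u" if "y \<in> ?S" for y
    proof -
      obtain q where "y = cmap c q" "c \<in> charts_at A q" "d \<in> charts_at B (F q)"
        using \<open>y \<in> ?S\<close> cA(1) dB(1) by (auto simp: charts_at_def)
      then show ?thesis
        using form_N_nonneg \<open>form (?N ?x0) u u = 0\<close> by simp
    qed
    then show "(\<forall>y\<in>?S. form (?N y) u u \<le> form (?N ?x0) u u) \<or> (\<forall>y\<in>?S. form (?N ?x0) u u \<le> form (?N y) u u)"
      by blast
  qed
  then have "form (D ?N ?x0 V) u u = 0"
    by metis
  with curve have "euler_lagrange ?N ?x0 u a V = 0"
    using form_N_commute[OF c d, of V a] by (simp add: euler_lagrange_def)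
  moreover have diff: "sq_dil c differentiable (at ?x0)" "M.G c differentiable (at ?x0)"
    using smooth_on_differentiable[OF smooth_on_sq_dil[OF cA(1)]] M.G_differentiable[OF c] cA by auto
  then have "(\<lambda>y. sq_dil c y *\<^sub>R M.G c y) differentiable (at ?x0)"
    by simp
  moreover have "\<phi> c d ` ?S \<subseteq> cmap d ` cdom d"
    using cinv_cmap[OF M.atlas cA(1)] by auto
  then have "pullback (\<phi> c d) (B.G d) differentiable (at ?x0)"
    using smooth_on_differentiable[OF smooth_on_pullback[OF S smooth_on_\<phi>[OF cA(1) dB(1)] B.smooth_on_G[OF dB(1)]] x0]
    by blast
  ultimately have "euler_lagrange (\<lambda>y. sq_dil c y *\<^sub>R M.G c y) ?x0 u a V
      = euler_lagrange (pullback (\<phi> c d) (B.G d)) ?x0 u a V"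
    using euler_lagrange_diff unfolding N_def[abs_def] by fastforce
  also have "\<dots> = 0"
    using euler_lagrange_pullback_vertical[OF cA(1) dB(1) x0 V] .
  \<comment> \<open>In the formula for \<lambda>^2 g the first term vanishes by the geodesic
    equation of \<open>g\<close> and the second because \<open>u\<close> is horizontal and
    \<open>V\<close> vertical; only the term with the derivative along \<open>V\<close> is
    left.\<close>
  finally have "D (sq_dil c) ?x0 V * g\<^sub>c c p u u = 0"
    using elG u(2)[OF V] posdef_form_commute[OF M.posdef_G[OF c], of u V]
    by (simp add: euler_lagrange_scaleR[OF diff])
  then show ?thesis
    using u(1) posdef_form_eq_0[OF M.posdef_G[OF c]] by simp
qed

text \<open>In the notation of the overview this is \<lambda>^4 Q, written without division. The
  remaining factor r^2 \<lambda>^2 is the square of the new Clairaut function.\<close>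

definition "R c d y = ((r (cinv c y))\<^sup>2 * sq_dil c y) *\<^sub>R N c d y"

lemma smooth_on_R:
  assumes "c \<in> A" "d \<in> B"
  shows "smooth_on (R c d) (cmap c ` (cdom c \<inter> F -` cdom d))"
proof -
  let ?S = "cmap c ` (cdom c \<inter> F -` cdom d)"
  have S: "open ?S"
    using open_F_domain[OF assms] .
  have "smooth_on (r \<circ> cinv c) ?S"
    using clairaut assms by (auto simp: clairaut_condition_def smooth_fun_def intro: smooth_on_subset)
  from smooth_on_mult[OF S this this] have "smooth_on (\<lambda>y. (r (cinv c y))\<^sup>2) ?S"
    by (simp add: power2_eq_square)
  moreover have "smooth_on (sq_dil c) ?S"
    using smooth_on_sq_dil[OF assms(1)] by (auto intro: smooth_on_subset)
  ultimately have "smooth_on (\<lambda>y. (r (cinv c y))\<^sup>2 * sq_dil c y) ?S"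
    by (rule smooth_on_mult[OF S])
  then show ?thesis
    using smooth_on_N[OF assms] unfolding smooth_on_def R_def[abs_def]
    by (intro allI Ck_on_scaleR[OF S]) simp_all
qed

lemma form_R:
  assumes "c \<in> charts_at A p" "d \<in> charts_at B (F p)"
  shows "form (R c d (cmap c p)) u v = (r p)\<^sup>2 * (dil p)\<^sup>2 * form (N c d (cmap c p)) u v"
  using cinv_cmap_p[OF assms] by (simp add: R_def scaleR_matrix_vector_assoc[symmetric])

text \<open>By the Clairaut relation and conservation of energy, \<open>R / \<lambda>\<^sup>4\<close> is a Killing tensor of \<open>g\<close>.\<close>

lemma killing_equation:
  assumes c: "c \<in> charts_at A p" and d: "d \<in> charts_at B (F p)"
  obtains a where "\<And>w. euler_lagrange (M.G c) (cmap c p) u a w = 0"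
    "(dil p)\<^sup>2 * (form (D (R c d) (cmap c p) u) u u + 2 * form (R c d (cmap c p)) u a)
      = 2 * D (sq_dil c) (cmap c p) u * form (R c d (cmap c p)) u u"
proof -
  let ?x0 = "cmap c p"
  note cA = cA[OF c d] and dB = dB[OF c d]
  obtain e \<alpha> where e: "e > 0" and \<alpha>: "geodesic_on A g {-e<..<e} \<alpha>" and \<alpha>0: "\<alpha> 0 = p"
    and u0: "vector_derivative (cmap c \<circ> \<alpha>) (at 0) = u"
    using M.geodesic_exists[OF c, of u] by blast
  let ?I = "{-e<..<e}"
  define x where "x = cmap c \<circ> \<alpha>"
  define v where "v s = vector_derivative x (at s)" for s
  define a where "a = vector_derivative v (at 0)"
  have x0_eq: "x 0 = ?x0" and v0: "v 0 = u"
    using \<alpha>0 u0 by (simp_all add: x_def v_def)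
  have I0: "0 \<in> ?I" and c0: "c \<in> charts_at A (\<alpha> 0)"
    using e c \<alpha>0 by simp_all
  have x': "(x has_vector_derivative u) (at 0)"
    using M.geodesic_position[OF \<alpha> I0 c0] v0 by (simp add: x_def v_def)
  have v': "(v has_vector_derivative a) (at 0)"
    using M.geodesic_velocity[OF \<alpha> I0 c0] by (simp add: x_def v_def[abs_def] a_def)
  have elG: "euler_lagrange (M.G c) ?x0 u a w = 0" for w
    using M.geodesic_euler_lagrange[OF \<alpha> I0 c0, of w] \<alpha>0 u0 by (simp add: x_def v_def[abs_def] a_def)
  have "(dil p)\<^sup>2 * (form (D (R c d) ?x0 u) u u + 2 * form (R c d ?x0) u a)
      = 2 * D (sq_dil c) ?x0 u * form (R c d ?x0) u u"
  proof (cases "u = 0")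
    \<comment> \<open>For \<open>u = 0\<close> the angle is a mere convention, but then both sides
      of the identity are 0.\<close>
    case False
    let ?J = "?I \<inter> \<alpha> -` (cdom c \<inter> F -` cdom d)"
    have J: "open ?J" "0 \<in> ?J"
      using geodesic_submersion_chart_domain[of ?I \<alpha> c d] \<alpha> cA dB e \<alpha>0 by (auto simp: geodesic_on_def)
    have vel: "velocity A \<alpha> s = tlift A c (\<alpha> s) (v s)" if "s \<in> ?J" for s
      using M.velocity_eq_tlift[OF \<alpha>, of s c] that cA(1) by (simp add: x_def v_def charts_at_def)
    have "velocity A \<alpha> 0 \<noteq> tzero"
      using vel[OF J(2)] v0 False tlift_eq_tzero_iff[OF M.atlas c0] by simp
    then have vel_nz: "velocity A \<alpha> s \<noteq> tzero" if "s \<in> ?I" for s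
      using M.velocity_nonzero[OF \<alpha> I0] that by blast
    obtain K where K: "\<And>t. t \<in> ?I \<Longrightarrow> r (\<alpha> t) * sin (angle_to_subspace g (\<alpha> t) (velocity A \<alpha> t)
        (horizontal_space A g B F (\<alpha> t))) = K"
      using clairaut_constant[OF \<alpha>] by blast
    obtain E where E: "\<And>t. t \<in> ?I \<Longrightarrow> g (\<alpha> t) (velocity A \<alpha> t) (velocity A \<alpha> t) = E"
      using M.energy_constant[OF \<alpha>] unfolding constant_on_def by metis
    \<comment> \<open>Squaring the Clairaut relation gives r^2 N(v, v) = K^2 E \<lambda>^2; a
      further factor \<lambda>^2 produces \<open>R\<close> on the left and \<lambda>^4 on the
      right.\<close>
    have R_along: "form (R c d (x s)) (v s) (v s) = K\<^sup>2 * E * (sq_dil c (x s))\<^sup>2" if s: "s \<in> ?J" for s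
    proof -
      have cs: "c \<in> charts_at A (\<alpha> s)" and ds: "d \<in> charts_at B (F (\<alpha> s))"
        using s cA(1) dB(1) by (auto simp: charts_at_def)
      have vs: "v s \<noteq> 0"
        using vel[OF s] vel_nz[of s] tlift_eq_tzero_iff[OF M.atlas cs] s by auto
      have Es: "g\<^sub>c c (\<alpha> s) (v s) (v s) = E"
        using E[of s] s vel[OF s] M.g_tlift[OF cs] by simp
      have "E > 0"
        using M.posdef_G[OF cs] vs Es by (auto simp: posdef_def)
      let ?n = "form (N c d (x s)) (v s) (v s)"
      have "?n \<ge> 0"
        using form_N_nonneg[OF cs ds] by (simp add: x_def)
      have "K = r (\<alpha> s) * sqrt (?n / ((dil (\<alpha> s))\<^sup>2 * E))"
        using K[of s] vel[OF s] angle_to_horizontal_space[OF cs ds vs] s Es by (simp add: x_def)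
      then have "K\<^sup>2 = (r (\<alpha> s))\<^sup>2 * (?n / ((dil (\<alpha> s))\<^sup>2 * E))"
        using \<open>?n \<ge> 0\<close> \<open>E > 0\<close> by (simp add: power_mult_distrib)
      then have "(r (\<alpha> s))\<^sup>2 * ?n = K\<^sup>2 * E * (dil (\<alpha> s))\<^sup>2"
        using \<open>E > 0\<close> dil_pos[of "\<alpha> s"] by simp
      then show ?thesis
        using form_R[OF cs ds, of "v s" "v s"] cinv_cmap_p[OF cs ds]
        by (simp add: x_def power2_eq_square mult_ac)
    qed
    have square: "((\<lambda>s. k * (q s)\<^sup>2) has_real_derivative k * (2 * q t * q')) (at t)"
      if "(q has_real_derivative q') (at t)" for q :: "real \<Rightarrow> real" and k q' t
      using that by (auto intro!: derivative_eq_intros)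
    have Rd: "(R c d has_derivative D (R c d) ?x0) (at ?x0)"
      using smooth_on_has_derivative[OF smooth_on_R[OF cA(1) dB(1)] cmap_in_F_domain[OF c d]] .
    have "((\<lambda>s. form (R c d (x s)) (v s) (v s)) has_real_derivative
        form (R c d ?x0) a u + form (D (R c d) ?x0 u) u u + form (R c d ?x0) u a) (at 0)"
      using has_real_derivative_form[OF Rd[folded x0_eq] x' v' v'] by (simp add: x0_eq v0)
    moreover have sq: "(sq_dil c has_derivative D (sq_dil c) ?x0) (at ?x0)"
      using smooth_on_has_derivative[OF smooth_on_sq_dil[OF cA(1)]] cA by blast
    then have "linear (D (sq_dil c) ?x0)"
      using has_derivative_bounded_linear bounded_linear.linear by blast
    then have "((\<lambda>s. sq_dil c (x s)) has_real_derivative D (sq_dil c) ?x0 u) (at 0)"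
      using has_derivative_compose[OF x'[unfolded has_vector_derivative_def] sq[folded x0_eq]]
      by (simp add: has_real_derivative_iff_has_vector_derivative has_vector_derivative_def linear_scale x0_eq)
    then have "((\<lambda>s. K\<^sup>2 * E * (sq_dil c (x s))\<^sup>2) has_real_derivative
        K\<^sup>2 * E * (2 * sq_dil c ?x0 * D (sq_dil c) ?x0 u)) (at 0)"
      using square[of "\<lambda>s. sq_dil c (x s)" _ 0 "K\<^sup>2 * E"] unfolding x0_eq by blast
    then have "((\<lambda>s. form (R c d (x s)) (v s) (v s)) has_real_derivative
        K\<^sup>2 * E * (2 * sq_dil c ?x0 * D (sq_dil c) ?x0 u)) (at 0)"
      by (rule has_field_derivative_transform_within_open[OF _ J]) (simp add: R_along)
    ultimately have "form (R c d ?x0) a u + form (D (R c d) ?x0 u) u u + form (R c d ?x0) u a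
        = K\<^sup>2 * E * (2 * sq_dil c ?x0 * D (sq_dil c) ?x0 u)"
      by (rule DERIV_unique)
    moreover have "form (R c d ?x0) a u = form (R c d ?x0) u a"
      using form_R[OF c d] form_N_commute[OF c d] by metis
    moreover have "form (R c d ?x0) u u = K\<^sup>2 * E * (sq_dil c ?x0)\<^sup>2"
      using R_along[OF J(2)] by (simp add: x0_eq v0)
    \<comment> \<open>The factor \<lambda>^2 in the claim turns K^2 E \<lambda>^4 into R(u, u) and
      so eliminates the constants \<open>K\<close> and \<open>E\<close>, which belong to the chosen
      geodesic.\<close>
    ultimately show ?thesis
      using cinv_cmap_p[OF c d] by (simp add: power2_eq_square algebra_simps)
  qed simp
  with elG show ?thesis
    by (rule that)
qed

abbreviation "g\<^sub>1 \<equiv> conformal_metric dil g"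

text \<open>In coordinates \<open>W\<close> is \<open>R(u, u)\<close> for the velocity \<open>u\<close>. Since \<open>R\<close> is \<open>\<lambda>\<^sup>4\<close> times a Killing
  tensor of \<open>g\<close> that annihilates the gradient of \<open>\<lambda>\<close>, it is a Killing tensor of \<open>\<lambda>\<^sup>2 g\<close>.\<close>

definition "W p v = (r p)\<^sup>2 * (dil p)\<^sup>2 * ((dil p)\<^sup>2 * g p v v
    - g' (F p) (differential A B F p v) (differential A B F p v))"

text \<open>At a fixed time the curve has velocity \<open>u\<close> and acceleration
  \<open>a\<close>, while the \<open>g\<close>-geodesic with the same velocity has acceleration
  \<open>b\<close>. The Killing equation controls the derivative of \<open>R\<close> with
  \<open>b\<close>; the correction 2 R(u, a - b) cancels its right-hand side exactly.\<close>

lemma W_constant: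
  assumes \<alpha>: "geodesic_on A g\<^sub>1 I \<alpha>"
  shows "(\<lambda>t. W (\<alpha> t) (velocity A \<alpha> t)) constant_on I"
proof -
  interpret C: metric_in_charts A g\<^sub>1
    by unfold_locales (rule riemannian_conformal_metric)
  have "((\<lambda>t. W (\<alpha> t) (velocity A \<alpha> t)) has_real_derivative 0) (at t)" if t: "t \<in> I" for t
  proof -
    obtain c where c: "c \<in> charts_at A (\<alpha> t)"
      using charts_at_nonempty[OF M.atlas] by blast
    obtain d where d: "d \<in> charts_at B (F (\<alpha> t))"
      using charts_at_nonempty[OF B.atlas] by blast
    note cA = cA[OF c d] and dB = dB[OF c d]
    define x where "x = cmap c \<circ> \<alpha>"
    define v where "v s = vector_derivative x (at s)" for s
    define a where "a = vector_derivative v (at t)"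
    let ?x = "x t" and ?u = "v t"
    have xt: "?x = cmap c (\<alpha> t)"
      by (simp add: x_def)
    have x': "(x has_vector_derivative ?u) (at t)"
      using C.geodesic_position[OF \<alpha> t c] by (simp add: x_def v_def)
    have v': "(v has_vector_derivative a) (at t)"
      using C.geodesic_velocity[OF \<alpha> t c] by (simp add: x_def v_def[abs_def] a_def)
    have diff: "sq_dil c differentiable (at ?x)" "M.G c differentiable (at ?x)"
      using smooth_on_differentiable[OF smooth_on_sq_dil[OF cA(1)]] M.G_differentiable[OF c] cA
      by (auto simp: xt)
    have "C.G c = (\<lambda>y. sq_dil c y *\<^sub>R M.G c y)"
      by (simp add: fun_eq_iff vec_eq_iff metric_matrix_def conformal_metric_def)
    then have elC: "euler_lagrange (\<lambda>y. sq_dil c y *\<^sub>R M.G c y) ?x ?u a w = 0" for w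
      using C.geodesic_euler_lagrange[OF \<alpha> t c, of w] by (simp add: x_def v_def[abs_def] a_def)
    obtain b where b: "\<And>w. euler_lagrange (M.G c) ?x ?u b w = 0"
      and killing: "(dil (\<alpha> t))\<^sup>2 * (form (D (R c d) ?x ?u) ?u ?u + 2 * form (R c d ?x) ?u b)
        = 2 * D (sq_dil c) ?x ?u * form (R c d ?x) ?u ?u"
      using killing_equation[OF c d, of ?u] unfolding xt by blast
    \<comment> \<open>R(u, h) depends on \<open>u\<close> only through its vertical part
      \<open>w\<close>, so the two geodesic equations need to be compared only against
      \<open>w\<close>.\<close>
    obtain w where w: "DF c d (\<alpha> t) w = 0" "\<And>w'. DF c d (\<alpha> t) w' = 0 \<Longrightarrow> g\<^sub>c c (\<alpha> t) w' (?u - w) = 0"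
      using vertical_part[OF c d] by blast
    have sq: "sq_dil c ?x = (dil (\<alpha> t))\<^sup>2"
      using cinv_cmap_p[OF c d] by (simp add: xt)
    have rescale: "k * (q * X) = Y * (q * Z)" if "k * X = Y * Z" for k q X Y Z :: real
      using arg_cong[OF that, of "(*) q"] by (simp only: mult.left_commute[of k] mult.left_commute[of Y])
    have N_w: "form (N c d ?x) ?u h = (dil (\<alpha> t))\<^sup>2 * form (M.G c ?x) w h" for h
      using form_N_vertical_part[OF c d w, of h] by (simp only: xt)
    have "euler_lagrange (M.G c) ?x ?u a w = form (M.G c ?x) w (a - b)"
      using b[of w] by (simp add: euler_lagrange_def algebra_simps inner_diff_right)
    \<comment> \<open>The term of the conformal change with g(u, u) carries the derivative of
      \<lambda>^2 along \<open>w\<close>, which is 0 since \<open>w\<close> is vertical. The next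
      two lines multiply by scalar factors to pass from \<open>g\<close> to \<open>N\<close> and
      then to \<open>R\<close>.\<close>
    then have "(dil (\<alpha> t))\<^sup>2 * form (M.G c ?x) w (a - b) = - D (sq_dil c) ?x ?u * form (M.G c ?x) w ?u"
      using elC[of w, unfolded euler_lagrange_scaleR[OF diff] sq] sq_dil_vertical_derivative[OF c d w(1)]
        posdef_form_commute[OF M.posdef_G[OF c], of w ?u]
      by (simp add: xt)
    then have "(dil (\<alpha> t))\<^sup>2 * form (N c d ?x) ?u (a - b) = - D (sq_dil c) ?x ?u * form (N c d ?x) ?u ?u"
      unfolding N_w by (rule rescale)
    then have "(dil (\<alpha> t))\<^sup>2 * form (R c d ?x) ?u (a - b) = - D (sq_dil c) ?x ?u * form (R c d ?x) ?u ?u"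
      unfolding xt form_R[OF c d] by (rule rescale)
    moreover have "form (R c d ?x) ?u (a - b) = form (R c d ?x) ?u a - form (R c d ?x) ?u b"
      by (simp add: algebra_simps inner_diff_right)
    ultimately have "(dil (\<alpha> t))\<^sup>2 * (form (D (R c d) ?x ?u) ?u ?u + 2 * form (R c d ?x) ?u a) = 0"
      using killing by (simp add: algebra_simps)
    moreover have "form (R c d ?x) a ?u = form (R c d ?x) ?u a"
      unfolding xt form_R[OF c d] form_N_commute[OF c d, of a] ..
    ultimately have zero: "form (R c d ?x) a ?u + form (D (R c d) ?x ?u) ?u ?u + form (R c d ?x) ?u a = 0"
      using dil_pos[of "\<alpha> t"] by simp
    have "(R c d has_derivative D (R c d) ?x) (at ?x)"
      using smooth_on_has_derivative[OF smooth_on_R[OF cA(1) dB(1)] cmap_in_F_domain[OF c d]] by (simp add: xt)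
    from has_real_derivative_form[OF this x' v' v']
    have "((\<lambda>s. form (R c d (x s)) (v s) (v s)) has_real_derivative 0) (at t)"
      unfolding zero .
    then show ?thesis
    proof (rule has_field_derivative_transform_within_open)
      let ?J = "I \<inter> \<alpha> -` (cdom c \<inter> F -` cdom d)"
      show "open ?J" "t \<in> ?J"
        using geodesic_submersion_chart_domain[of I \<alpha> c d] \<alpha> cA dB t by (auto simp: geodesic_on_def)
      fix s assume s: "s \<in> ?J"
      then have cs: "c \<in> charts_at A (\<alpha> s)" and ds: "d \<in> charts_at B (F (\<alpha> s))" and "s \<in> I"
        using cA(1) dB(1) by (auto simp: charts_at_def)
      show "form (R c d (x s)) (v s) (v s) = W (\<alpha> s) (velocity A \<alpha> s)"
        using C.velocity_eq_tlift[OF \<alpha> \<open>s \<in> I\<close> cs] form_R[OF cs ds, of "v s" "v s"]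
          form_N_tlift[OF cs ds, of "v s" "v s"]
        by (simp add: W_def x_def v_def)
    qed
  qed
  then have "((\<lambda>t. W (\<alpha> t) (velocity A \<alpha> t)) has_derivative (\<lambda>h. 0)) (at t within I)" if "t \<in> I" for t
    using that by (auto simp: has_real_derivative_iff_has_vector_derivative has_vector_derivative_def
        intro: has_derivative_at_withinI)
  moreover have "convex I"
    using \<alpha> by (simp add: geodesic_on_def is_interval_convex)
  ultimately show ?thesis
    unfolding constant_on_def by (intro has_derivative_zero_constant)
qed

section \<open>The Clairaut relation for the rescaled metric\<close>

lemma smooth_fun_dil_r: "smooth_fun A (\<lambda>p. dil p * r p)"
  unfolding smooth_fun_def
proof
  fix c assume c: "c \<in> A"
  have "smooth_on (dil \<circ> cinv c) (cmap c ` cdom c)" "smooth_on (r \<circ> cinv c) (cmap c ` cdom c)"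
    using conformal clairaut c
    by (auto simp: conformal_submersion_def clairaut_condition_def smooth_fun_def)
  from smooth_on_mult[OF open_cmap_cdom[OF M.atlas c] this]
  show "smooth_on ((\<lambda>p. dil p * r p) \<circ> cinv c) (cmap c ` cdom c)"
    by (simp add: comp_def)
qed

text \<open>At zero velocity the sine is 1 by convention, so the Clairaut quantity reduces to a
  function on the manifold evaluated along the curve; by the chain rule its derivative is 0.\<close>

lemma smooth_fun_constant_at_rest:
  assumes \<alpha>: "geodesic_on A g\<^sub>1 I \<alpha>" and rest: "\<And>t. t \<in> I \<Longrightarrow> velocity A \<alpha> t = tzero"
    and h: "smooth_fun A h"
  shows "(\<lambda>t. h (\<alpha> t)) constant_on I"
proof -
  interpret C: metric_in_charts A g\<^sub>1
    by unfold_locales (rule riemannian_conformal_metric)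
  have "((\<lambda>t. h (\<alpha> t)) has_derivative (\<lambda>s. 0)) (at t)" if t: "t \<in> I" for t
  proof -
    obtain c where c: "c \<in> charts_at A (\<alpha> t)"
      using charts_at_nonempty[OF M.atlas] by blast
    then have cA: "c \<in> A" "\<alpha> t \<in> cdom c"
      by (auto simp: charts_at_def)
    let ?x = "cmap c \<circ> \<alpha>"
    have "vector_derivative ?x (at t) = 0"
      using C.velocity_eq_tlift[OF \<alpha> t c] rest[OF t] tlift_eq_tzero_iff[OF M.atlas c] by metis
    then have x': "(?x has_derivative (\<lambda>s. 0)) (at t)"
      using C.geodesic_position[OF \<alpha> t c] by (simp add: has_vector_derivative_def)
    have hc: "smooth_on (h \<circ> cinv c) (cmap c ` cdom c)"
      using h cA by (simp add: smooth_fun_def)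
    have xt: "?x t \<in> cmap c ` cdom c"
      using cA by simp
    from has_derivative_compose[OF x' smooth_on_has_derivative[OF hc xt]]
    have "((\<lambda>s. (h \<circ> cinv c) (?x s)) has_derivative (\<lambda>s. 0)) (at t)"
      by (simp add: linear_0[OF smooth_on_linear_D[OF hc xt, simplified]])
    then show ?thesis
      by (rule has_derivative_transform_within_open[OF _ C.geodesic_chart_domain[OF \<alpha> t c]])
        (use t cA cinv_cmap[OF M.atlas cA(1)] in auto)
  qed
  then have "((\<lambda>t. h (\<alpha> t)) has_derivative (\<lambda>s. 0)) (at t within I)" if "t \<in> I" for t
    using that by (blast intro: has_derivative_at_withinI)
  moreover have "convex I"
    using \<alpha> by (simp add: geodesic_on_def is_interval_convex)
  ultimately show ?thesis
    unfolding constant_on_def by (intro has_derivative_zero_constant)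
qed

lemma clairaut_condition_conformal_metric:
  "clairaut_condition A g\<^sub>1 B F (\<lambda>p. dil p * r p)"
  unfolding clairaut_condition_def
proof (intro conjI allI impI)
  show "smooth_fun A (\<lambda>p. dil p * r p)"
    by (rule smooth_fun_dil_r)
  show "dil p * r p > 0" for p
    using dil_pos r_pos by simp
next
  interpret C: metric_in_charts A g\<^sub>1
    by unfold_locales (rule riemannian_conformal_metric)
  fix I \<alpha> assume \<alpha>: "geodesic_on A g\<^sub>1 I \<alpha>"
  let ?sin = "\<lambda>t. sin (angle_to_subspace g\<^sub>1 (\<alpha> t) (velocity A \<alpha> t) (horizontal_space A g\<^sub>1 B F (\<alpha> t)))"
  have sin_eq: "?sin t = sin (angle_to_subspace g (\<alpha> t) (velocity A \<alpha> t) (horizontal_space A g B F (\<alpha> t)))" for t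
    using dil_pos by (simp add: angle_to_subspace_conformal_metric horizontal_space_conformal_metric)
  show "(\<lambda>t. dil (\<alpha> t) * r (\<alpha> t) * ?sin t) constant_on I"
  proof (cases "\<exists>t\<in>I. velocity A \<alpha> t \<noteq> tzero")
    case False
    then have rest: "velocity A \<alpha> t = tzero" if "t \<in> I" for t
      using that by blast
    have "?sin t = 1" if "t \<in> I" for t
      unfolding sin_eq unfolding rest[OF that] by (rule angle_tzero)
    then show ?thesis
      using smooth_fun_constant_at_rest[OF \<alpha> rest smooth_fun_dil_r]
      unfolding constant_on_def by (metis mult.right_neutral)
  next
    case True
    then have nz: "velocity A \<alpha> t \<noteq> tzero" if "t \<in> I" for t
      using C.velocity_nonzero[OF \<alpha>] that by blast
    obtain E where E: "\<And>t. t \<in> I \<Longrightarrow> g\<^sub>1 (\<alpha> t) (velocity A \<alpha> t) (velocity A \<alpha> t) = E"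
      using C.energy_constant[OF \<alpha>] unfolding constant_on_def by metis
    obtain w where w: "\<And>t. t \<in> I \<Longrightarrow> W (\<alpha> t) (velocity A \<alpha> t) = w"
      using W_constant[OF \<alpha>] unfolding constant_on_def by metis
    \<comment> \<open>The squared sine is N(u, u) over the new energy \<open>E\<close>, and
      \<open>w\<close> is (\<lambda> r)^2 N(u, u); positivity of \<lambda> r selects the
      root.\<close>
    have "dil (\<alpha> t) * r (\<alpha> t) * ?sin t = sqrt (w / E)" if t: "t \<in> I" for t
    proof -
      obtain c where c: "c \<in> charts_at A (\<alpha> t)"
        using charts_at_nonempty[OF M.atlas] by blast
      obtain d where d: "d \<in> charts_at B (F (\<alpha> t))"
        using charts_at_nonempty[OF B.atlas] by blast
      define u where "u = vector_derivative (cmap c \<circ> \<alpha>) (at t)"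
      have vel: "velocity A \<alpha> t = tlift A c (\<alpha> t) u"
        using C.velocity_eq_tlift[OF \<alpha> t c] by (simp add: u_def)
      have "u \<noteq> 0"
        using nz[OF t] tlift_eq_tzero_iff[OF M.atlas c] by (simp add: vel)
      let ?n = "form (N c d (cmap c (\<alpha> t))) u u"
      have "w = (dil (\<alpha> t) * r (\<alpha> t))\<^sup>2 * ?n"
        using w[OF t] form_N_tlift[OF c d, of u u] by (simp add: W_def vel power_mult_distrib mult_ac)
      moreover have "E = (dil (\<alpha> t))\<^sup>2 * g\<^sub>c c (\<alpha> t) u u"
        using E[OF t] M.g_tlift[OF c, of u u] by (simp add: conformal_metric_def vel)
      moreover have "dil (\<alpha> t) * r (\<alpha> t) > 0"
        using dil_pos r_pos by simp
      ultimately show ?thesis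
        unfolding sin_eq unfolding vel angle_to_horizontal_space[OF c d \<open>u \<noteq> 0\<close>]
        by (simp only: times_divide_eq_right[symmetric] real_sqrt_mult real_sqrt_abs abs_of_pos)
    qed
    then show ?thesis
      unfolding constant_on_def by blast
  qed
qed

end

theorem corollary9:
  fixes M :: "('a::{t2_space,second_countable_topology}, 'm::finite) chart set"
    and g :: "('a, 'm) metric"
    and B :: "('b::{t2_space,second_countable_topology}, 'n::finite) chart set"
    and g' :: "('b, 'n) metric"
    and F :: "'a \<Rightarrow> 'b"
    and dil f :: "'a \<Rightarrow> real"
  assumes "riemannian_manifold M g"
    and "riemannian_manifold B g'"
    and "\<And>b. connected (F -` {b})"
    and "smooth_fun M f"
    and "clairaut_conformal_submersion M g B g' F dil (\<lambda>p. exp (f p))"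
  shows "riemannian_manifold M (conformal_metric dil g) \<and>
    clairaut_riemannian_submersion M (conformal_metric dil g) B g' F (\<lambda>p. dil p * exp (f p))"
proof -
  interpret clairaut_in_charts M g B g' F dil "\<lambda>p. exp (f p)"
    using assms by unfold_locales (simp_all add: clairaut_conformal_submersion_def)
  show ?thesis
    using riemannian_conformal_metric conformal_metric_riemannian_submersion
      clairaut_condition_conformal_metric
    by (simp add: clairaut_riemannian_submersion_def)
qed

end
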